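(* Let $x,z\in\{1,\dots,20\}$ (possibly equal), $y\in\{1,\dots,6\}$, let $\mathcal{P}$ and $\mathcal{Q}$ be the $x$-th and $z$-th simple pieces in the list of twenty 1-simple pieces, and let $\mathcal{T}'=\{C_y\}$. Let $\mathcal{P}'=F_2(\mathcal{P})$, $\mathcal{Q}'=F_2(\mathcal{Q})$ and $\overline{\mathcal{Q}'}=(F_1\circ F_2)(\mathcal{Q}')$. Then for every integer $n\ge 1$, $$s_n(\mathcal{P}'\cup\mathcal{T}'\cup\overline{\mathcal{Q}'})=\sum_{\substack{i+j\le 2m\\ k+l\le 2p\\ m+p=n+1}}P_x(i,j,m)\cdot T_y(i,j,k,l,m,p)\cdot P_z(k,l,p)+s_n(\mathcal{P})+s_n(\mathcal{Q}),$$ where the sum is over positive integers $i,j,k,l,m,p$ satisfying the indicated constraints. Here $P_x(i,j,m)$ is the number of standard puzzles with $m$ columns having the $x$-th simple piece as a support and whose rightmost column has bottom entry $i$ and top entry $i+j$ (and similarly $P_z(k,l,p)$), and $T_y(i,j,k,l,m,p)=Q_y(i,j,k,l,m,p)$, $T_{y+3}(i,j,k,l,m,p)=Q_y(k,l,i,j,p,m)$ for $y\in\{1,2,3\}$, with $$Q_1(i,j,k,l,m,p)=\sum_{\substack{0\le a\le k-1\\0\le b\le j-1}}\binom{i+a-1}{a}\binom{b+k+l-a-1}{b}\binom{2m-i-b+2p-k-l}{2p-k-l},$$ $$Q_2(i,j,k,l,m,p)=\sum_{\substack{0\le a\le k-1\\0\le b\le j-1\\0\le c\le l-1}}\binom{i+a-1}{a}\binom{b+k-a-1}{b}\binom{c+j-b-1}{c}\binom{2m+2p-k-c-i-j}{2m-i-j},$$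 $$Q_3(i,j,k,l,m,p)=\sum_{a=0}^{k-1}\binom{i+j+a-1}{a}\binom{2m+2p-i-j-a}{2p-a}.$$
   Context: A standard piece is a $2\times 2$ matrix whose four entries are $1,2,3,4$, each occurring exactly once. A standard $n$-puzzle is a $2\times(n+1)$ matrix whose entries are $1,2,\dots,2n+2$, each occurring exactly once; its pieces are its $n$ submatrices formed by two consecutive columns. The reduction of a piece is the standard piece obtained by replacing its four distinct entries by $1,2,3,4$ in an order-preserving way. A set $\mathcal{P}$ of standard pieces is a support of a puzzle if the reduction of each piece of the puzzle lies in $\mathcal{P}$. For $n\ge 1$, $S_n(\mathcal{P})$ is the set of standard $n$-puzzles having $\mathcal{P}$ as a support, and $s_n(\mathcal{P})=|S_n(\mathcal{P})|$. In the definition of $P_x(i,j,m)$ the puzzle with $m$ columns has entries $1,\dots,2m$; for $m=1$ the only puzzle considered is the single column with bottom entry $1$ and top entry $2$, so $P_x(1,1,1)=1$. The 24 standard pieces are: $A_1=\left[\begin{smallmatrix}4&3\\1&2\end{smallmatrix}\right]$, $A_2=\left[\begin{smallmatrix}3&4\\1&2\end{smallmatrix}\right]$, $A_3=\left[\begin{smallmatrix}2&4\\1&3\end{smallmatrix}\right]$, $A_4=\left[\begin{smallmatrix}3&4\\2&1\end{smallmatrix}\right]$, $A_5=\left[\begin{smallmatrix}4&3\\2&1\end{smallmatrix}\right]$, $A_6=\left[\begin{smallmatrix}4&2\\3&1\end{smallmatrix}\right]$; $B_1=\left[\begin{smallmatrix}4&2\\1&3\end{smallmatrix}\right]$, $B_2=\left[\begin{smallmatrix}3&2\\1&4\end{smallmatrix}\right]$,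 $B_3=\left[\begin{smallmatrix}2&3\\1&4\end{smallmatrix}\right]$, $B_4=\left[\begin{smallmatrix}3&1\\2&4\end{smallmatrix}\right]$, $B_5=\left[\begin{smallmatrix}4&1\\2&3\end{smallmatrix}\right]$, $B_6=\left[\begin{smallmatrix}4&1\\3&2\end{smallmatrix}\right]$; $C_i$ and $D_i$ are obtained from $B_i$ and $A_i$ respectively by exchanging the top and bottom rows, $1\le i\le 6$. $F_1$ sends $A_i,B_i,C_i,D_i$ to $A_{i+3},C_{i+3},B_{i+3},D_{i+3}$ (subscripts mod 6), i.e. it exchanges the left and right columns of a piece; $F_2$ sends $A_i,B_i,C_i,D_i$ to $D_i,C_i,B_i,A_i$, i.e. it exchanges the top and bottom rows. They are applied to sets of pieces elementwise. The list of the twenty 1-simple pieces: 1. $\{A_1,A_2,A_3,A_4,A_5,A_6\}$; 2. $\{A_3\}$; 3. $\{A_6\}$; 4. $\{A_1,A_2,A_3\}$; 5. $\{A_4,A_5,A_6\}$; 6. $\{A_2,A_3,A_4\}$; 7. $\{A_1,A_5,A_6\}$; 8. $\{A_1,A_2,A_3,A_4,A_5\}$; 9. $\{A_1,A_2,A_4,A_5,A_6\}$; 10. $\{A_1,A_2,A_4,A_5\}$; 11. $\{A_1,A_2\}$; 12. $\{A_4,A_5\}$; 13. $\{A_1,A_5\}$; 14. $\{A_2,A_4\}$; 15. $\{A_4\}$; 16. $\{A_1\}$; 17. $\{A_2,A_3\}$; 18. $\{A_5,A_6\}$; 19. $\{A_2\}$; 20. $\{A_5\}$. *)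

theory Defs
  imports "Jordan_Normal_Form.Column_Operations"
begin

text \<open>Matrices are indexed from 0: row 0 is the top row, row 1 the bottom row. Puzzles are indexed
  here by their number of columns, so a standard \<open>n\<close>-puzzle has \<open>n + 1\<close> columns.\<close>

definition col_puzzles :: "nat \<Rightarrow> nat mat set" where
  "col_puzzles m =
     {X \<in> carrier_mat 2 m. bij_betw (\<lambda>rc. X $$ rc) ({0..<2} \<times> {0..<m}) {1..2 * m}}"

definition standard_puzzles :: "nat \<Rightarrow> nat mat set" where
  "standard_puzzles n = col_puzzles (n + 1)"

definition standard_pieces :: "nat mat set" where
  "standard_pieces = standard_puzzles 1"

definition piece_at :: "nat mat \<Rightarrow> nat \<Rightarrow> nat mat" where
  "piece_at X c = mat 2 2 (\<lambda>(r, d). X $$ (r, c + d))"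

text \<open>Each entry is replaced by its rank among the entries.\<close>

definition reduction :: "nat mat \<Rightarrow> nat mat" where
  "reduction M = map_mat (\<lambda>v. card {w \<in> elements_mat M. w \<le> v}) M"

definition is_support :: "nat mat set \<Rightarrow> nat mat \<Rightarrow> bool" where
  "is_support P X \<longleftrightarrow> P \<subseteq> standard_pieces \<and> (\<forall>c. c + 1 < dim_col X \<longrightarrow> reduction (piece_at X c) \<in> P)"

definition Sset :: "nat \<Rightarrow> nat mat set \<Rightarrow> nat mat set" where
  "Sset n P = {X \<in> standard_puzzles n. is_support P X}"

definition snum :: "nat \<Rightarrow> nat mat set \<Rightarrow> nat" where
  "snum n P = card (Sset n P)"

definition pieceA :: "nat \<Rightarrow> nat mat" where
  "pieceA i = mat_of_rows_list 2
     ([[[4, 3],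
        [1, 2]],
       [[3, 4],
        [1, 2]],
       [[2, 4],
        [1, 3]],
       [[3, 4],
        [2, 1]],
       [[4, 3],
        [2, 1]],
       [[4, 2],
        [3, 1]]] ! (i - 1))"

definition pieceB :: "nat \<Rightarrow> nat mat" where
  "pieceB i = mat_of_rows_list 2
     ([[[4, 2],
        [1, 3]],
       [[3, 2],
        [1, 4]],
       [[2, 3],
        [1, 4]],
       [[3, 1],
        [2, 4]],
       [[4, 1],
        [2, 3]],
       [[4, 1],
        [3, 2]]] ! (i - 1))"

definition pieceC :: "nat \<Rightarrow> nat mat" where
  "pieceC i = swaprows 0 1 (pieceB i)"

definition pieceD :: "nat \<Rightarrow> nat mat" where
  "pieceD i = swaprows 0 1 (pieceA i)"

definition F1 :: "nat mat \<Rightarrow> nat mat" where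
  "F1 M = swapcols 0 1 M"

definition F2 :: "nat mat \<Rightarrow> nat mat" where
  "F2 M = swaprows 0 1 M"

text \<open>Adding 3 to a subscript modulo 6 is \<open>i \<mapsto> (i + 2) mod 6 + 1\<close> on \<open>{1..6}\<close>.\<close>

lemma F_pieces:
  assumes "i \<in> {1..6}"
  shows "F1 (pieceA i) = pieceA ((i + 2) mod 6 + 1)" "F1 (pieceB i) = pieceC ((i + 2) mod 6 + 1)"
    "F1 (pieceC i) = pieceB ((i + 2) mod 6 + 1)" "F1 (pieceD i) = pieceD ((i + 2) mod 6 + 1)"
    "F2 (pieceA i) = pieceD i" "F2 (pieceB i) = pieceC i"
    "F2 (pieceC i) = pieceB i" "F2 (pieceD i) = pieceA i"
proof -
  have i: "i = 1 \<or> i = 2 \<or> i = 3 \<or> i = 4 \<or> i = 5 \<or> i = 6"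
    using assms by auto
  have rows: "swaprows 0 (Suc 0) (mat_of_rows_list 2 [[a, b], [c, d]])
      = mat_of_rows_list 2 [[c, d], [a, b]]" for a b c d :: nat
    by (rule eq_matI) (auto simp: mat_swaprows_def mat_of_rows_list_def less_2_cases_iff less_Suc_eq)
  have cols: "swapcols 0 (Suc 0) (mat_of_rows_list 2 [[a, b], [c, d]])
      = mat_of_rows_list 2 [[b, a], [d, c]]" for a b c d :: nat
    by (rule eq_matI) (auto simp: mat_swapcols_def mat_of_rows_list_def less_2_cases_iff less_Suc_eq)
  note defs = F1_def F2_def pieceA_def pieceB_def pieceC_def pieceD_def
  show "F1 (pieceA i) = pieceA ((i + 2) mod 6 + 1)"
    using i by (elim disjE) (simp_all add: defs rows cols)
  show "F1 (pieceB i) = pieceC ((i + 2) mod 6 + 1)"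
    using i by (elim disjE) (simp_all add: defs rows cols)
  show "F1 (pieceC i) = pieceB ((i + 2) mod 6 + 1)"
    using i by (elim disjE) (simp_all add: defs rows cols)
  show "F1 (pieceD i) = pieceD ((i + 2) mod 6 + 1)"
    using i by (elim disjE) (simp_all add: defs rows cols)
  show "F2 (pieceA i) = pieceD i"
    using i by (elim disjE) (simp_all add: defs rows cols)
  show "F2 (pieceB i) = pieceC i"
    using i by (elim disjE) (simp_all add: defs rows cols)
  show "F2 (pieceC i) = pieceB i"
    using i by (elim disjE) (simp_all add: defs rows cols)
  show "F2 (pieceD i) = pieceA i"
    using i by (elim disjE) (simp_all add: defs rows cols)
qed

definition simple_piece :: "nat \<Rightarrow> nat mat set" where
  "simple_piece x = pieceA ` (
     [{1, 2, 3, 4, 5, 6}, {3}, {6}, {1, 2, 3}, {4, 5, 6},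
      {2, 3, 4}, {1, 5, 6}, {1, 2, 3, 4, 5}, {1, 2, 4, 5, 6}, {1, 2, 4, 5},
      {1, 2}, {4, 5}, {1, 5}, {2, 4}, {4},
      {1}, {2, 3}, {5, 6}, {2}, {5}] ! (x - 1))"

text \<open>For one column there are no pieces, and only the column with bottom entry 1 and top entry 2
  should be counted. This needs no special case: the other column has its top entry below its
  bottom entry, so it is not counted for any \<open>j\<close>.\<close>

definition Pnum :: "nat \<Rightarrow> nat \<Rightarrow> nat \<Rightarrow> nat \<Rightarrow> nat" where
  "Pnum x i j m = card {X \<in> col_puzzles m. is_support (simple_piece x) X
      \<and> X $$ (1, m - 1) = i \<and> X $$ (0, m - 1) = i + j}"

text \<open>The subtractions below do not truncate when \<open>i, j, k, l \<ge> 1\<close>, \<open>i + j \<le> 2 * m\<close> and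
  \<open>k + l \<le> 2 * p\<close>.\<close>

definition Q1 :: "nat \<Rightarrow> nat \<Rightarrow> nat \<Rightarrow> nat \<Rightarrow> nat \<Rightarrow> nat \<Rightarrow> nat" where
  "Q1 i j k l m p =
     (\<Sum>a = 0..k - 1. \<Sum>b = 0..j - 1.
        ((i + a - 1) choose a) * ((b + k + l - a - 1) choose b)
        * ((2 * m - i - b + 2 * p - k - l) choose (2 * p - k - l)))"

definition Q2 :: "nat \<Rightarrow> nat \<Rightarrow> nat \<Rightarrow> nat \<Rightarrow> nat \<Rightarrow> nat \<Rightarrow> nat" where
  "Q2 i j k l m p =
     (\<Sum>a = 0..k - 1. \<Sum>b = 0..j - 1. \<Sum>c = 0..l - 1.
        ((i + a - 1) choose a) * ((b + k - a - 1) choose b) * ((c + j - b - 1) choose c)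
        * ((2 * m + 2 * p - k - c - i - j) choose (2 * m - i - j)))"

definition Q3 :: "nat \<Rightarrow> nat \<Rightarrow> nat \<Rightarrow> nat \<Rightarrow> nat \<Rightarrow> nat \<Rightarrow> nat" where
  "Q3 i j k l m p =
     (\<Sum>a = 0..k - 1.
        ((i + j + a - 1) choose a) * ((2 * m + 2 * p - i - j - a) choose (2 * p - a)))"

definition Tnum :: "nat \<Rightarrow> nat \<Rightarrow> nat \<Rightarrow> nat \<Rightarrow> nat \<Rightarrow> nat \<Rightarrow> nat \<Rightarrow> nat" where
  "Tnum y i j k l m p =
     (if y = 1 then Q1 i j k l m p
      else if y = 2 then Q2 i j k l m p
      else if y = 3 then Q3 i j k l m p
      else if y = 4 then Q1 k l i j p m
      else if y = 5 then Q2 k l i j p m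
      else Q3 k l i j p m)"

end

theory Submission
  imports Defs
begin

text \<open>A column is up if its top entry exceeds its bottom entry. Both columns are down in the pieces of
  \<open>F\<^sub>2(P)\<close>, both are up in those of \<open>F\<^sub>1(Q)\<close>, and \<open>C\<^sub>y\<close> goes from down to up; since no available
  piece goes from up to down, a puzzle consists of \<open>m\<close> down columns followed by \<open>p\<close> up columns. The
  cases \<open>p = 0\<close> and \<open>m = 0\<close> contribute \<open>s\<^sub>n(P)\<close> and \<open>s\<^sub>n(Q)\<close> by exchanging rows and by reversing
  columns. Otherwise the puzzle is determined by the reductions of its two parts and by the two-letter
  word that tells, for each entry value, the part in which it lies. The number of words for which the
  middle piece is \<open>C\<^sub>y\<close> is found by cutting a word at the positions of the entries of that piece.\<close>

section \<open>Two-letter words\<close>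

text \<open>A reduction depends only on the relative order inside a piece. So every piece except the
  middle one sees a single part, and the middle one sees only four end entries and the word; for
  fixed i, j, k, l, m, p the word and the two parts are therefore chosen independently, whence the
  product of three factors. The left part is the row exchange of a puzzle counted by
  \<open>Pnum\<close>, the right part the column reversal of another. This puts the last columns of
  both next to the cut: i and i + j stand there at the top and bottom of the left column, k and k +
  l at the bottom and top of the right one. The six pieces C_y are the six ways to interleave these
  two increasing pairs. For y = 1, 2, 3 the words are counted with two, three and one cut; the
  summation indices a, b, c count the letters of the other kind between one cut and the next. A half
  turn of the piece leads from C_y to C_(y+3) and exchanges the two letters, hence the exchanged
  arguments in the last three cases.\<close>

text \<open>The position, counted from 1, of the \<open>k\<close>-th letter \<open>c\<close>; a junk value if there is none.\<close>

fun pos :: "bool \<Rightarrow> nat \<Rightarrow> bool list \<Rightarrow> nat" where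
  "pos c 0 w = 0"
| "pos c (Suc k) [] = 0"
| "pos c (Suc k) (x # w) = Suc (if x = c then pos c k w else pos c (Suc k) w)"

text \<open>The letter \<open>c\<close> is a parameter so that each count serves both orders of the
  two parts: \<open>words_neg\<close> passes from one letter to the other.\<close>

definition words :: "bool \<Rightarrow> nat \<Rightarrow> nat \<Rightarrow> bool list set" where
  "words c s t = {w. count_list w c = s \<and> count_list w (\<not> c) = t}"

lemma count_list_bool_length: "count_list w c + count_list w (\<not> c) = length w"
  by (induction w) auto

lemma length_words: "w \<in> words c s t \<Longrightarrow> length w = s + t"
  using count_list_bool_length[of w c] by (simp add: words_def)

lemma words_neg: "words (\<not> c) s t = words c t s"
  by (auto simp: words_def)

lemma finite_words: "finite (words c s t)"
proof (rule finite_subset)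
  show "words c s t \<subseteq> {w. set w \<subseteq> UNIV \<and> length w = s + t}"
    by (auto simp: length_words)
qed (rule finite_lists_length_eq, simp)

text \<open>Sorting words by their first letter gives Pascal's rule.\<close>

lemma card_words: "card (words c s t) = (s + t) choose s"
proof (induction "s + t" arbitrary: s t)
  case 0
  then have "words c s t = {[]}"
    using length_words[of _ c s t] by (auto simp: words_def)
  with 0 show ?case by simp
next
  case (Suc n)
  have Cons: "x # w \<in> words c s t \<longleftrightarrow>
      (if x = c then 0 < s \<and> w \<in> words c (s - 1) t else 0 < t \<and> w \<in> words c s (t - 1))" for x w
    by (auto simp: words_def)
  have "words c s t = (if 0 < s then (#) c ` words c (s - 1) t else {}) \<union>
      (if 0 < t then (#) (\<not> c) ` words c s (t - 1) else {})" (is "?W = ?A \<union> ?B")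
  proof (rule Set.set_eqI)
    fix w
    show "w \<in> ?W \<longleftrightarrow> w \<in> ?A \<union> ?B"
    proof (cases w)
      case Nil
      with Suc.hyps(2) show ?thesis by (auto dest: length_words)
    qed (auto simp: Cons)
  qed
  moreover have "?A \<inter> ?B = {}" by auto
  ultimately have "card ?W = card ?A + card ?B"
    by (simp add: card_Un_disjoint finite_words)
  also have "card ?A = (if 0 < s then card (words c (s - 1) t) else 0)"
    by (simp add: card_image)
  also have "card ?B = (if 0 < t then card (words c s (t - 1)) else 0)"
    by (simp add: card_image)
  finally show ?case
    using Suc.hyps(1)[of "s - 1" t] Suc.hyps(1)[of s "t - 1"] Suc.hyps(2)
    by (cases s; cases t) auto
qed

section \<open>Positions of letters and cuts of a word\<close>

lemma pos_append_left:
  "k \<le> count_list u c \<Longrightarrow> pos c k (u @ v) = pos c k u \<and> pos c k u \<le> length u"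
proof (induction c k u rule: pos.induct)
  case (3 c k x w)
  then show ?case by (cases "x = c") auto
qed auto

lemma pos_append_right:
  "count_list u c < k \<Longrightarrow> pos c k (u @ v) = length u + pos c (k - count_list u c) v"
proof (induction c k u rule: pos.induct)
  case (3 c k x w)
  then show ?case by (cases "x = c") auto
qed auto

lemma split_at_letter:
  assumes "1 \<le> i" "i \<le> count_list w c"
  obtains u v where "w = u @ c # v" "count_list u c = i - 1"
  using assms
proof (induction w arbitrary: i thesis)
  case (Cons x w)
  show ?case
  proof (cases "x = c \<and> i = 1")
    case True
    with Cons.prems(1)[of "[]" w] show ?thesis by simp
  next
    case False
    with Cons.prems have "1 \<le> (if x = c then i - 1 else i)"
      "(if x = c then i - 1 else i) \<le> count_list w c"
      by (auto split: if_splits)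
    from Cons.IH[OF _ this] obtain u v
      where "w = u @ c # v" "count_list u c = (if x = c then i - 1 else i) - 1"
      by blast
    with False Cons.prems show ?thesis
      by (intro Cons.prems(1)[of "x # u" v]) auto
  qed
qed auto

text \<open>A cut at the \<open>i\<close>-th \<open>c\<close>: whatever lies in \<open>u\<close>
  comes before it, whatever lies in \<open>v\<close> is shifted by \<open>length u + 1\<close>.
  Comparing with the \<open>i\<close>-th \<open>c\<close> thus amounts to asking whether
  \<open>u\<close> already holds \<open>k\<close> opposite letters.\<close>

lemma pos_split:
  assumes "count_list u c = i - 1" "1 \<le> i"
  shows "pos c i (u @ c # v) = length u + 1"
    and "0 < r \<Longrightarrow> pos c (i + r) (u @ c # v) = length u + 1 + pos c r v"
    and "k \<le> count_list u (\<not> c) \<Longrightarrow> pos (\<not> c) k (u @ c # v) \<le> length u"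
    and "count_list u (\<not> c) < k \<Longrightarrow>
      pos (\<not> c) k (u @ c # v) = length u + 1 + pos (\<not> c) (k - count_list u (\<not> c)) v"
proof -
  show "pos c i (u @ c # v) = length u + 1"
    using assms pos_append_right[of u c i "c # v"] by simp
  show "pos c (i + r) (u @ c # v) = length u + 1 + pos c r v" if "0 < r"
    using assms that pos_append_right[of u c "i + r" "c # v"] by simp
  show "pos (\<not> c) k (u @ c # v) \<le> length u" if "k \<le> count_list u (\<not> c)"
    using pos_append_left[OF that, of "c # v"] by simp
  show "pos (\<not> c) k (u @ c # v) = length u + 1 + pos (\<not> c) (k - count_list u (\<not> c)) v"
    if "count_list u (\<not> c) < k"
    using that pos_append_right[of u "\<not> c" k "c # v"]
    by (cases "k - count_list u (\<not> c)") auto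
qed

lemma pos_pos: "0 < k \<Longrightarrow> k \<le> count_list w c \<Longrightarrow> 0 < pos c k w"
  by (cases k; cases w) auto

lemma pos_less:
  assumes "i < k" "k \<le> count_list w c"
  shows "pos c i w < pos c k w"
proof (cases "i = 0")
  case True
  with assms pos_pos show ?thesis by simp
next
  case False
  with assms obtain u v where w: "w = u @ c # v" "count_list u c = i - 1"
    using split_at_letter[of i w c] by auto
  with False assms show ?thesis
    using pos_split(1)[OF w(2), of v] pos_split(2)[OF w(2), of "k - i" v]
      pos_pos[of "k - i" v c] by simp
qed

lemma pos_mono_on: "strict_mono_on {1..count_list w c} (\<lambda>k. pos c k w)"
  by (auto intro!: strict_mono_onI pos_less)

text \<open>This makes a word a relabelling: ranks inside one part become the values that this part
  occupies in the whole puzzle.\<close>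

lemma pos_bij:
  "bij_betw (\<lambda>k. pos c k w) {1..count_list w c} {v \<in> {1..length w}. w ! (v - 1) = c}"
proof (rule bij_betwI')
  fix i k
  assume "i \<in> {1..count_list w c}" "k \<in> {1..count_list w c}"
  then show "(pos c i w = pos c k w) = (i = k)"
    using pos_less[of i k w c] pos_less[of k i w c] by (cases i k rule: linorder_cases) auto
next
  fix k
  assume k: "k \<in> {1..count_list w c}"
  then obtain u v where w: "w = u @ c # v" "count_list u c = k - 1"
    using split_at_letter[of k w c] by auto
  then show "pos c k w \<in> {v \<in> {1..length w}. w ! (v - 1) = c}"
    using pos_split(1)[OF w(2), of v] k by auto
next
  fix v
  assume v: "v \<in> {v \<in> {1..length w}. w ! (v - 1) = c}"
  define u where "u = take (v - 1) w"
  have "w = u @ c # drop v w"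
    using v id_take_nth_drop[of "v - 1" w] unfolding u_def by auto
  moreover from this have "count_list w c = count_list u c + 1 + count_list (drop v w) c"
    by (metis add.assoc add.commute count_list.simps(2) count_list_append)
  moreover have "length u + 1 = v"
    using v unfolding u_def by auto
  ultimately show "\<exists>k\<in>{1..count_list w c}. v = pos c k w"
    using pos_split(1)[of u c "count_list u c + 1" "drop v w"]
    by (intro bexI[of _ "count_list u c + 1"]) auto
qed

text \<open>A word in which the \<open>i\<close>-th \<open>c\<close> precedes the
  \<open>k\<close>-th opposite letter is cut uniquely as \<open>u @ c # v\<close>, where
  \<open>u\<close> has \<open>i - 1\<close> letters \<open>c\<close> and some \<open>a < k\<close>
  opposite ones; this leaves \<open>(i + a - 1) choose a\<close> choices of \<open>u\<close>. The
  further condition \<open>\<Psi>\<close> may depend on \<open>a\<close> and \<open>v\<close> only,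
  so that the count of the tails can be cut again.\<close>

lemma card_words_split:
  assumes "1 \<le> i" "i \<le> s" "k \<le> t"
    and \<Psi>: "\<And>u a v. a < k \<Longrightarrow> u \<in> words c (i - 1) a \<Longrightarrow> v \<in> words c (s - i) (t - a) \<Longrightarrow>
      \<Psi> (u @ c # v) \<longleftrightarrow> \<Psi>' a v"
  shows "card {w \<in> words c s t. pos c i w < pos (\<not> c) k w \<and> \<Psi> w} =
    (\<Sum>a<k. ((i + a - 1) choose a) * card {v \<in> words c (s - i) (t - a). \<Psi>' a v})"
    (is "card ?W = _")
proof -
  define D where "D = Sigma {..<k} (\<lambda>a. words c (i - 1) a \<times> {v \<in> words c (s - i) (t - a). \<Psi>' a v})"
  have "bij_betw (\<lambda>(a, u, v). u @ c # v) D ?W"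
    unfolding bij_betw_def
  proof (intro conjI subset_antisym subsetI)
    show "inj_on (\<lambda>(a, u, v). u @ c # v) D"
    proof (rule inj_onI)
      fix x y
      assume "x \<in> D" "y \<in> D" "(\<lambda>(a, u, v). u @ c # v) x = (\<lambda>(a, u, v). u @ c # v) y"
      moreover obtain a u v a' u' v' where xy: "x = (a, u, v)" "y = (a', u', v')"
        by (cases x; cases y)
      ultimately have *: "(a, u, v) \<in> D" "(a', u', v') \<in> D" "u @ c # v = u' @ c # v'"
        by auto
      then have "count_list u c = i - 1" "count_list u' c = i - 1"
        "count_list u (\<not> c) = a" "count_list u' (\<not> c) = a'"
        by (auto simp: D_def words_def)
      \<comment> \<open>Both prefixes end just before the \<open>i\<close>-th \<open>c\<close> of
        the same word.\<close>
      with *(3) have "length u = length u'"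
        using pos_split(1)[of u c i v] pos_split(1)[of u' c i v'] assms(1) by simp
      with *(3) \<open>count_list u (\<not> c) = a\<close> \<open>count_list u' (\<not> c) = a'\<close>
      show "x = y" by (auto simp: xy)
    qed
  next
    fix w
    assume "w \<in> (\<lambda>(a, u, v). u @ c # v) ` D"
    then obtain a u v where w: "w = u @ c # v" "a < k" "u \<in> words c (i - 1) a"
      "v \<in> words c (s - i) (t - a)" "\<Psi>' a v"
      by (auto simp: D_def)
    then have "count_list u c = i - 1" "count_list u (\<not> c) = a"
      by (auto simp: words_def)
    with w assms show "w \<in> ?W"
      using pos_split(1)[of u c i v] pos_split(4)[of u c i k v] pos_pos[of "k - a" v "\<not> c"]
      by (auto simp: words_def)
  next
    fix w
    assume w: "w \<in> ?W"
    then have "i \<le> count_list w c"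
      using assms(2) by (simp add: words_def)
    with assms(1) obtain u v where uv: "w = u @ c # v" "count_list u c = i - 1"
      by (rule split_at_letter)
    \<comment> \<open>Otherwise the \<open>k\<close>-th opposite letter would lie in
      \<open>u\<close>, before the \<open>i\<close>-th \<open>c\<close>.\<close>
    have "count_list u (\<not> c) < k"
    proof (rule ccontr)
      assume "\<not> ?thesis"
      with uv assms(1) w show False
        using pos_split(1)[OF uv(2), of v] pos_split(3)[OF uv(2), of k v] by simp
    qed
    moreover have "u \<in> words c (i - 1) (count_list u (\<not> c))"
      "v \<in> words c (s - i) (t - count_list u (\<not> c))"
      using w uv assms by (auto simp: words_def)
    ultimately have "(count_list u (\<not> c), u, v) \<in> D"
      using w uv \<Psi>[of "count_list u (\<not> c)" u v] by (auto simp: D_def)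
    then show "w \<in> (\<lambda>(a, u, v). u @ c # v) ` D"
      using uv(1) by force
  qed
  then have "card ?W = card D"
    by (simp add: bij_betw_same_card)
  also have "\<dots> = (\<Sum>a<k. card (words c (i - 1) a \<times> {v \<in> words c (s - i) (t - a). \<Psi>' a v}))"
    unfolding D_def by (rule card_SigmaI) (auto simp: finite_words)
  also have "\<dots> = (\<Sum>a<k. ((i + a - 1) choose a) * card {v \<in> words c (s - i) (t - a). \<Psi>' a v})"
  proof (rule sum.cong)
    fix a
    have "(i - 1 + a) choose (i - 1) = (i + a - 1) choose a"
      using assms(1) binomial_symmetric[of a "i + a - 1"] by simp
    then show "card (words c (i - 1) a \<times> {v \<in> words c (s - i) (t - a). \<Psi>' a v}) =
      ((i + a - 1) choose a) * card {v \<in> words c (s - i) (t - a). \<Psi>' a v}"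
      by (simp add: card_cartesian_product card_words)
  qed simp
  finally show ?thesis .
qed

lemma card_words_before:
  assumes "1 \<le> i" "i \<le> s" "k \<le> t"
  shows "card {w \<in> words c s t. pos c i w < pos (\<not> c) k w} =
    (\<Sum>a<k. ((i + a - 1) choose a) * ((s - i + (t - a)) choose (s - i)))"
  using card_words_split[OF assms, of c "\<lambda>_. True" "\<lambda>_ _. True"] by (simp add: card_words)

section \<open>The three binomial sums as numbers of words\<close>

lemma sum_upto_pred: "1 \<le> k \<Longrightarrow> (\<Sum>a = 0..k - 1. f a) = (\<Sum>a<k. f a)" for k :: nat
  by (rule sum.cong) auto

text \<open>Two cuts, at the \<open>i\<close>-th \<open>c\<close> and at the
  \<open>(k + l)\<close>-th opposite letter. The index \<open>a\<close> counts opposite letters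
  before the first cut, \<open>b\<close> the letters \<open>c\<close> between the cuts. In the tail
  the letters change roles, and ranks drop by \<open>i\<close> and by \<open>a\<close>.\<close>

lemma card_words_Q1:
  assumes "1 \<le> i" "1 \<le> j" "1 \<le> k" "1 \<le> l" "i + j \<le> 2 * m" "k + l \<le> 2 * p"
  shows "card {w \<in> words c (2 * m) (2 * p).
      pos c i w < pos (\<not> c) k w \<and> pos (\<not> c) (k + l) w < pos c (i + j) w} = Q1 i j k l m p"
proof -
  have "card {w \<in> words c (2 * m) (2 * p).
      pos c i w < pos (\<not> c) k w \<and> pos (\<not> c) (k + l) w < pos c (i + j) w} =
    (\<Sum>a<k. ((i + a - 1) choose a) * card {v \<in> words c (2 * m - i) (2 * p - a).
      pos (\<not> c) (k + l - a) v < pos c j v})"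
  proof (rule card_words_split)
    fix u a v
    assume *: "a < k" "u \<in> words c (i - 1) a" "v \<in> words c (2 * m - i) (2 * p - a)"
    then have "count_list u c = i - 1" "count_list u (\<not> c) = a"
      by (auto simp: words_def)
    with * assms show "pos (\<not> c) (k + l) (u @ c # v) < pos c (i + j) (u @ c # v) \<longleftrightarrow>
        pos (\<not> c) (k + l - a) v < pos c j v"
      using pos_split(2)[of u c i j v] pos_split(4)[of u c i "k + l" v] by simp
  qed (use assms in auto)
  also have "\<dots> = (\<Sum>a<k. ((i + a - 1) choose a) * (\<Sum>b<j. ((k + l - a + b - 1) choose b) *
      ((2 * p - a - (k + l - a) + (2 * m - i - b)) choose (2 * p - a - (k + l - a)))))"
  proof (rule sum.cong)
    fix a
    assume "a \<in> {..<k}"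
    with assms show "((i + a - 1) choose a) * card {v \<in> words c (2 * m - i) (2 * p - a).
        pos (\<not> c) (k + l - a) v < pos c j v} =
      ((i + a - 1) choose a) * (\<Sum>b<j. ((k + l - a + b - 1) choose b) *
        ((2 * p - a - (k + l - a) + (2 * m - i - b)) choose (2 * p - a - (k + l - a))))"
      using card_words_before[of "k + l - a" "2 * p - a" j "2 * m - i" "\<not> c"]
      by (simp add: words_neg)
  qed simp
  also have "\<dots> = Q1 i j k l m p"
    unfolding Q1_def sum_upto_pred[OF assms(2)] sum_upto_pred[OF assms(3)] sum_distrib_left
  proof (intro sum.cong refl)
    fix a b
    assume "a \<in> {..<k}" "b \<in> {..<j}"
    with assms have "k + l - a + b - 1 = b + k + l - a - 1" "2 * p - a - (k + l - a) = 2 * p - k - l"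
      "2 * p - k - l + (2 * m - i - b) = 2 * m - i - b + 2 * p - k - l"
      by auto
    then show "(i + a - 1 choose a) * ((k + l - a + b - 1 choose b) *
        (2 * p - a - (k + l - a) + (2 * m - i - b) choose (2 * p - a - (k + l - a)))) =
      (i + a - 1 choose a) * (b + k + l - a - 1 choose b) *
        (2 * m - i - b + 2 * p - k - l choose (2 * p - k - l))"
      by simp
  qed
  finally show ?thesis .
qed

text \<open>Three cuts, at the \<open>i\<close>-th \<open>c\<close>, the \<open>k\<close>-th
  opposite letter and the \<open>(i + j)\<close>-th \<open>c\<close>. The indices count opposite
  letters before the first cut, letters \<open>c\<close> between the first two, and opposite letters
  between the last two.\<close>

lemma card_words_Q2:
  assumes "1 \<le> i" "1 \<le> j" "1 \<le> k" "1 \<le> l" "i + j \<le> 2 * m" "k + l \<le> 2 * p"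
  shows "card {w \<in> words c (2 * m) (2 * p). pos c i w < pos (\<not> c) k w \<and>
      pos (\<not> c) k w < pos c (i + j) w \<and> pos c (i + j) w < pos (\<not> c) (k + l) w} = Q2 i j k l m p"
proof -
  have "card {w \<in> words c (2 * m) (2 * p). pos c i w < pos (\<not> c) k w \<and>
      pos (\<not> c) k w < pos c (i + j) w \<and> pos c (i + j) w < pos (\<not> c) (k + l) w} =
    (\<Sum>a<k. ((i + a - 1) choose a) * card {v \<in> words c (2 * m - i) (2 * p - a).
      pos (\<not> c) (k - a) v < pos c j v \<and> pos c j v < pos (\<not> c) (k + l - a) v})"
  proof (rule card_words_split)
    fix u a v
    assume *: "a < k" "u \<in> words c (i - 1) a" "v \<in> words c (2 * m - i) (2 * p - a)"
    then have "count_list u c = i - 1" "count_list u (\<not> c) = a"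
      by (auto simp: words_def)
    with * assms show "(pos (\<not> c) k (u @ c # v) < pos c (i + j) (u @ c # v) \<and>
        pos c (i + j) (u @ c # v) < pos (\<not> c) (k + l) (u @ c # v)) \<longleftrightarrow>
        (pos (\<not> c) (k - a) v < pos c j v \<and> pos c j v < pos (\<not> c) (k + l - a) v)"
      using pos_split(2)[of u c i j v] pos_split(4)[of u c i "k + l" v] pos_split(4)[of u c i k v]
      by simp
  qed (use assms in auto)
  \<comment> \<open>The summation variable \<open>c\<close> of the innermost sum is a number; it
    shadows the letter \<open>c\<close>.\<close>
  also have "\<dots> = (\<Sum>a<k. ((i + a - 1) choose a) * (\<Sum>b<j. ((k - a + b - 1) choose b) *
      (\<Sum>c<l. ((j - b + c - 1) choose c) *
        ((2 * m - i - b - (j - b) + (2 * p - a - (k - a) - c)) choose (2 * m - i - b - (j - b))))))"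
  proof (intro sum.cong arg_cong2[where f = times] refl)
    fix a
    assume a: "a \<in> {..<k}"
    \<comment> \<open>Written with the letter \<open>\<not> c\<close> and its negation
      \<open>\<not> \<not> c\<close>, the condition has the form that
      \<open>card_words_split\<close> expects for the second cut.\<close>
    have "card {v \<in> words c (2 * m - i) (2 * p - a).
        pos (\<not> c) (k - a) v < pos c j v \<and> pos c j v < pos (\<not> c) (k + l - a) v} =
      card {v \<in> words (\<not> c) (2 * p - a) (2 * m - i).
        pos (\<not> c) (k - a) v < pos (\<not> \<not> c) j v \<and> pos c j v < pos (\<not> c) (k - a + l) v}"
      using a by (simp add: words_neg)
    also have "\<dots> = (\<Sum>b<j. ((k - a + b - 1) choose b) *
      card {v \<in> words (\<not> c) (2 * p - a - (k - a)) (2 * m - i - b). pos c (j - b) v < pos (\<not> c) l v})"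
    proof (rule card_words_split)
      fix u b v
      assume *: "b < j" "u \<in> words (\<not> c) (k - a - 1) b"
        "v \<in> words (\<not> c) (2 * p - a - (k - a)) (2 * m - i - b)"
      then have "count_list u (\<not> c) = k - a - 1" "count_list u c = b"
        by (auto simp: words_def)
      with * a assms show "pos c j (u @ (\<not> c) # v) < pos (\<not> c) (k - a + l) (u @ (\<not> c) # v) \<longleftrightarrow>
          pos c (j - b) v < pos (\<not> c) l v"
        using pos_split(2)[of u "\<not> c" "k - a" l v] pos_split(4)[of u "\<not> c" "k - a" j v] by simp
    qed (use assms a in auto)
    also have "\<dots> = (\<Sum>b<j. ((k - a + b - 1) choose b) *
      (\<Sum>c<l. ((j - b + c - 1) choose c) *
        ((2 * m - i - b - (j - b) + (2 * p - a - (k - a) - c)) choose (2 * m - i - b - (j - b)))))"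
    proof (intro sum.cong arg_cong2[where f = times] refl)
      fix b
      assume "b \<in> {..<j}"
      with assms a show "card {v \<in> words (\<not> c) (2 * p - a - (k - a)) (2 * m - i - b).
          pos c (j - b) v < pos (\<not> c) l v} = (\<Sum>c<l. ((j - b + c - 1) choose c) *
          ((2 * m - i - b - (j - b) + (2 * p - a - (k - a) - c)) choose (2 * m - i - b - (j - b))))"
        using card_words_before[of "j - b" "2 * m - i - b" l "2 * p - a - (k - a)" c]
        by (simp add: words_neg)
    qed
    finally show "card {v \<in> words c (2 * m - i) (2 * p - a).
        pos (\<not> c) (k - a) v < pos c j v \<and> pos c j v < pos (\<not> c) (k + l - a) v} =
      (\<Sum>b<j. ((k - a + b - 1) choose b) * (\<Sum>c<l. ((j - b + c - 1) choose c) *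
        ((2 * m - i - b - (j - b) + (2 * p - a - (k - a) - c)) choose (2 * m - i - b - (j - b)))))" .
  qed
  also have "\<dots> = Q2 i j k l m p"
    unfolding Q2_def sum_upto_pred[OF assms(2)] sum_upto_pred[OF assms(3)]
      sum_upto_pred[OF assms(4)] sum_distrib_left
  proof (intro sum.cong refl)
    fix a b c
    assume "a \<in> {..<k}" "b \<in> {..<j}" "c \<in> {..<l}"
    with assms have "k - a + b - 1 = b + k - a - 1" "j - b + c - 1 = c + j - b - 1"
      "2 * m - i - b - (j - b) = 2 * m - i - j"
      "2 * m - i - j + (2 * p - a - (k - a) - c) = 2 * m + 2 * p - k - c - i - j"
      by auto
    then show "(i + a - 1 choose a) * ((k - a + b - 1 choose b) * ((j - b + c - 1 choose c) *
        (2 * m - i - b - (j - b) + (2 * p - a - (k - a) - c) choose (2 * m - i - b - (j - b))))) =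
      (i + a - 1 choose a) * (b + k - a - 1 choose b) * (c + j - b - 1 choose c) *
        (2 * m + 2 * p - k - c - i - j choose (2 * m - i - j))"
      by simp
  qed
  finally show ?thesis .
qed

text \<open>One cut, at the \<open>(i + j)\<close>-th \<open>c\<close>: once it precedes the
  \<open>k\<close>-th opposite letter, the order of all four entries of the middle piece is
  fixed.\<close>

lemma card_words_Q3:
  assumes "1 \<le> i" "1 \<le> j" "1 \<le> k" "1 \<le> l" "i + j \<le> 2 * m" "k + l \<le> 2 * p"
  shows "card {w \<in> words c (2 * m) (2 * p). pos c (i + j) w < pos (\<not> c) k w} = Q3 i j k l m p"
proof -
  have "card {w \<in> words c (2 * m) (2 * p). pos c (i + j) w < pos (\<not> c) k w} =
    (\<Sum>a<k. ((i + j + a - 1) choose a) *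
      ((2 * m - (i + j) + (2 * p - a)) choose (2 * m - (i + j))))"
    using assms by (intro card_words_before) auto
  also have "\<dots> = Q3 i j k l m p"
    unfolding Q3_def sum_upto_pred[OF assms(3)]
  proof (intro sum.cong refl)
    fix a
    assume "a \<in> {..<k}"
    with assms have "2 * m - (i + j) + (2 * p - a) = 2 * m + 2 * p - i - j - a"
      by auto
    moreover have "(2 * m - (i + j) + (2 * p - a)) choose (2 * m - (i + j)) =
        (2 * m - (i + j) + (2 * p - a)) choose (2 * p - a)"
      using binomial_symmetric[of "2 * m - (i + j)" "2 * m - (i + j) + (2 * p - a)"] by simp
    ultimately show "(i + j + a - 1 choose a) *
        (2 * m - (i + j) + (2 * p - a) choose (2 * m - (i + j))) =
      (i + j + a - 1 choose a) * (2 * m + 2 * p - i - j - a choose (2 * p - a))"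
      by simp
  qed
  finally show ?thesis .
qed

text \<open>The relative order of the four entries of \<open>C\<^sub>y\<close>, when the columns on its left and on its right
  hold the \<open>i\<close>-th and \<open>(i + j)\<close>-th smallest entries of the left part and the \<open>k\<close>-th and
  \<open>(k + l)\<close>-th smallest entries of the right part, and \<open>w\<close> records which entries belong to the left
  part.\<close>

definition fits :: "nat \<Rightarrow> nat \<Rightarrow> nat \<Rightarrow> nat \<Rightarrow> nat \<Rightarrow> bool list \<Rightarrow> bool" where
  "fits y i j k l w \<longleftrightarrow>
     (let tl = pos True i w; bl = pos True (i + j) w; br = pos False k w; tr = pos False (k + l) w in
      if y = 1 then tl < br \<and> tr < bl
      else if y = 2 then tl < br \<and> br < bl \<and> bl < tr
      else if y = 3 then bl < br
      else if y = 4 then br < tl \<and> bl < tr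
      else if y = 5 then br < tl \<and> tl < tr \<and> tr < bl
      else tr < tl)"

text \<open>For y = 4, 5, 6 the conditions are those of y = 1, 2, 3 with the letters exchanged, so
  the same counts apply with letter \<open>False\<close> and with \<open>k\<close>,
  \<open>l\<close>, \<open>p\<close> in the place of \<open>i\<close>, \<open>j\<close>,
  \<open>m\<close>.\<close>

lemma card_fits:
  assumes "1 \<le> i" "1 \<le> j" "1 \<le> k" "1 \<le> l" "i + j \<le> 2 * m" "k + l \<le> 2 * p"
  shows "card {w \<in> words True (2 * m) (2 * p). fits y i j k l w} = Tnum y i j k l m p"
proof -
  have "words True (2 * m) (2 * p) = words False (2 * p) (2 * m)"
    using words_neg[of True] by simp
  then show ?thesis
    using card_words_Q1[OF assms, of True] card_words_Q1[OF assms(3,4,1,2,6,5), of False]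
      card_words_Q2[OF assms, of True] card_words_Q2[OF assms(3,4,1,2,6,5), of False]
      card_words_Q3[OF assms, of True] card_words_Q3[OF assms(3,4,1,2,6,5), of False]
    by (simp add: fits_def Tnum_def Let_def)
qed

section \<open>Reductions and symmetries\<close>

lemma elements_mat_2_2:
  "M \<in> carrier_mat 2 2 \<Longrightarrow> elements_mat M = {M $$ (0, 0), M $$ (0, 1), M $$ (1, 0), M $$ (1, 1)}"
  by (auto simp: elements_mat_def less_2_cases_iff)

lemma piece_at_carrier: "piece_at X c \<in> carrier_mat 2 2"
  by (simp add: piece_at_def)

lemma reduction_carrier: "M \<in> carrier_mat r c \<Longrightarrow> reduction M \<in> carrier_mat r c"
  by (simp add: reduction_def)

text \<open>Ranks increase strictly along the finite set of entries: a larger entry is counted in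
  its own rank but not in that of a smaller one.\<close>

lemma reduction_less_iff:
  assumes M: "M \<in> carrier_mat 2 2" and "r < 2" "s < 2" "r' < 2" "s' < 2"
  shows "reduction M $$ (r, s) < reduction M $$ (r', s') \<longleftrightarrow> M $$ (r, s) < M $$ (r', s')"
proof -
  define rank where "rank v = card {w \<in> elements_mat M. w \<le> v}" for v
  have fin: "finite (elements_mat M)"
    by (simp add: elements_mat_2_2[OF M])
  have elem: "M $$ (r, s) \<in> elements_mat M" "M $$ (r', s') \<in> elements_mat M"
    using assms by (auto simp: elements_mat_2_2[OF M] less_2_cases_iff)
  have less: "rank v < rank v'" if "v < v'" "v' \<in> elements_mat M" for v v'
  proof -
    have "v' \<in> {w \<in> elements_mat M. w \<le> v'} - {w \<in> elements_mat M. w \<le> v}"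
      using that by simp
    then have "{w \<in> elements_mat M. w \<le> v} \<subset> {w \<in> elements_mat M. w \<le> v'}"
      using that by fastforce
    then show ?thesis
      unfolding rank_def using fin by (intro psubset_card_mono) auto
  qed
  have "rank (M $$ (r, s)) < rank (M $$ (r', s')) \<longleftrightarrow> M $$ (r, s) < M $$ (r', s')"
    using less elem by (metis less_asym' linorder_cases less_irrefl)
  then show ?thesis
    using assms by (simp add: reduction_def rank_def)
qed

text \<open>An increasing relabelling carries the entries up to \<open>v\<close> onto those up to
  \<open>f v\<close>, so no rank changes. Gluing preserves reductions for this reason.\<close>

lemma reduction_map_mat:
  assumes "strict_mono_on (elements_mat M) f"
  shows "reduction (map_mat f M) = reduction M"
proof (rule eq_matI)
  fix r c
  assume rc: "r < dim_row (reduction M)" "c < dim_col (reduction M)"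
  then have v: "M $$ (r, c) \<in> elements_mat M"
    by (auto simp: reduction_def)
  have "elements_mat (map_mat f M) = f ` elements_mat M"
    by (auto simp: elements_mat_def)
  moreover have "f w \<le> f (M $$ (r, c)) \<longleftrightarrow> w \<le> M $$ (r, c)" if "w \<in> elements_mat M" for w
    using that v strict_mono_on_less_eq[OF assms] by blast
  ultimately have "{w \<in> elements_mat (map_mat f M). w \<le> f (M $$ (r, c))} =
      f ` {w \<in> elements_mat M. w \<le> M $$ (r, c)}"
    by auto
  moreover have "inj_on f {w \<in> elements_mat M. w \<le> M $$ (r, c)}"
    using strict_mono_on_imp_inj_on[OF assms] by (rule inj_on_subset) auto
  ultimately show "reduction (map_mat f M) $$ (r, c) = reduction M $$ (r, c)"
    using rc by (simp add: reduction_def card_image)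
qed (auto simp: reduction_def)

lemma col_puzzles_carrier: "X \<in> col_puzzles m \<Longrightarrow> X \<in> carrier_mat 2 m"
  by (simp add: col_puzzles_def)

lemma col_puzzles_range:
  "X \<in> col_puzzles m \<Longrightarrow> r < 2 \<Longrightarrow> c < m \<Longrightarrow> X $$ (r, c) \<in> {1..2 * m}"
  unfolding col_puzzles_def by (auto dest!: bij_betwE)

lemma col_puzzles_inj:
  assumes "X \<in> col_puzzles m" "r < 2" "c < m" "r' < 2" "c' < m" "X $$ (r, c) = X $$ (r', c')"
  shows "r = r' \<and> c = c'"
proof -
  have "inj_on (\<lambda>rc. X $$ rc) ({0..<2} \<times> {0..<m})"
    using assms(1) by (simp add: col_puzzles_def bij_betw_def)
  from inj_onD[OF this assms(6)] assms show ?thesis by auto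
qed

lemma standard_pieces_eq: "standard_pieces = col_puzzles 2"
  by (simp add: standard_pieces_def standard_puzzles_def numeral_2_eq_2)

lemma reduction_standard:
  assumes "K \<in> standard_pieces"
  shows "reduction K = K"
proof (rule eq_matI)
  note K = assms[unfolded standard_pieces_eq]
  have "elements_mat K = (\<lambda>rc. K $$ rc) ` ({0..<2} \<times> {0..<2})"
    using col_puzzles_carrier[OF K] by (auto simp: elements_mat_def)
  also have "\<dots> = {1..4}"
    using K by (simp add: col_puzzles_def bij_betw_def)
  finally have E: "elements_mat K = {1..4}" .
  fix r c
  assume "r < dim_row K" "c < dim_col K"
  moreover from this have "K $$ (r, c) \<in> {1..4}"
    unfolding E[symmetric] by auto
  then have "{w \<in> {1..4}. w \<le> K $$ (r, c)} = {1..K $$ (r, c)}"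
    by auto
  ultimately show "reduction K $$ (r, c) = K $$ (r, c)"
    by (simp add: reduction_def E)
qed (auto simp: reduction_def)

lemma reduction_eq_iff:
  assumes M: "M \<in> carrier_mat 2 2" and K: "K \<in> standard_pieces"
  shows "reduction M = K \<longleftrightarrow> (\<forall>r<2. \<forall>s<2. \<forall>r'<2. \<forall>s'<2.
    M $$ (r, s) < M $$ (r', s') \<longleftrightarrow> K $$ (r, s) < K $$ (r', s'))" (is "_ \<longleftrightarrow> ?ord")
proof
  assume "reduction M = K"
  with reduction_less_iff[OF M] show ?ord by blast
next
  assume ord: ?ord
  let ?I = "{0..<2} \<times> {0..<2} :: (nat \<times> nat) set"
  note K' = K[unfolded standard_pieces_eq]
  \<comment> \<open>\<open>g\<close> finds the cell of a value in \<open>K\<close>, so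
    \<open>M\<close> is \<open>K\<close> relabelled by \<open>v \<mapsto> M $$ g v\<close>; the
    common order of the entries makes this relabelling strictly increasing.\<close>
  define g where "g = inv_into ?I (\<lambda>rc. K $$ rc)"
  have inj: "inj_on (\<lambda>rc. K $$ rc) ?I"
    using K' by (simp add: col_puzzles_def bij_betw_def)
  have g: "g (K $$ rc) = rc" if "rc \<in> ?I" for rc
    unfolding g_def using inj that by simp
  have "M = map_mat (\<lambda>v. M $$ g v) K"
    using M col_puzzles_carrier[OF K'] g by (intro eq_matI) auto
  moreover have "strict_mono_on (elements_mat K) (\<lambda>v. M $$ g v)"
  proof (rule strict_mono_onI)
    fix v w
    assume "v \<in> elements_mat K" "w \<in> elements_mat K" "v < w"
    moreover have "\<exists>rc\<in>?I. v = K $$ rc" if "v \<in> elements_mat K" for v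
      using that col_puzzles_carrier[OF K'] by (auto simp: elements_mat_def)
    ultimately obtain r s r' s' where "v = K $$ (r, s)" "w = K $$ (r', s')"
      "(r, s) \<in> ?I" "(r', s') \<in> ?I"
      by (metis surj_pair)
    with ord \<open>v < w\<close> g show "M $$ g v < M $$ g w" by auto
  qed
  ultimately have "reduction M = reduction K"
    by (metis reduction_map_mat)
  with reduction_standard[OF K] show "reduction M = K" by simp
qed

section \<open>Row exchange and column reversal\<close>

definition rev_cols :: "nat mat \<Rightarrow> nat mat" where
  "rev_cols X = mat (dim_row X) (dim_col X) (\<lambda>(r, c). X $$ (r, dim_col X - 1 - c))"

lemma F2_carrier: "X \<in> carrier_mat r m \<Longrightarrow> F2 X \<in> carrier_mat r m"
  by (simp add: F2_def mat_swaprows_def)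

lemma F2_index: "X \<in> carrier_mat 2 m \<Longrightarrow> r < 2 \<Longrightarrow> c < m \<Longrightarrow> F2 X $$ (r, c) = X $$ (1 - r, c)"
  by (auto simp: F2_def mat_swaprows_def less_2_cases_iff)

lemma F2_F2: "X \<in> carrier_mat 2 m \<Longrightarrow> F2 (F2 X) = X"
  using F2_carrier[of X 2 m] F2_carrier[of "F2 X" 2 m]
  by (intro eq_matI) (auto simp: F2_index[of _ m] less_2_cases_iff)

lemma rev_cols_carrier: "X \<in> carrier_mat r m \<Longrightarrow> rev_cols X \<in> carrier_mat r m"
  by (simp add: rev_cols_def)

lemma rev_cols_index:
  "X \<in> carrier_mat r' m \<Longrightarrow> r < r' \<Longrightarrow> c < m \<Longrightarrow> rev_cols X $$ (r, c) = X $$ (r, m - 1 - c)"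
  by (simp add: rev_cols_def)

lemma rev_cols_rev_cols: "X \<in> carrier_mat r m \<Longrightarrow> rev_cols (rev_cols X) = X"
  by (intro eq_matI) (auto simp: rev_cols_def)

text \<open>\<open>F1\<close> exchanges columns 0 and 1 at any width, so \<open>rev_cols\<close>
  takes its place on whole puzzles. \<open>F2\<close> can be used as it is, since every puzzle has
  two rows.\<close>

lemma F1_eq_rev_cols: "M \<in> carrier_mat 2 2 \<Longrightarrow> F1 M = rev_cols M"
  by (intro eq_matI) (auto simp: F1_def mat_swapcols_def rev_cols_def less_2_cases_iff)

lemma col_puzzles_reindex:
  assumes X: "X \<in> col_puzzles m" and Y: "Y \<in> carrier_mat 2 m"
    and \<sigma>: "bij_betw \<sigma> ({0..<2} \<times> {0..<m}) ({0..<2} \<times> {0..<m})"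
    and Y_eq: "\<And>rc. rc \<in> {0..<2} \<times> {0..<m} \<Longrightarrow> Y $$ rc = X $$ \<sigma> rc"
  shows "Y \<in> col_puzzles m"
proof -
  have "bij_betw ((\<lambda>rc. X $$ rc) \<circ> \<sigma>) ({0..<2} \<times> {0..<m}) {1..2 * m}"
    using X by (intro bij_betw_trans[OF \<sigma>]) (simp add: col_puzzles_def)
  also have "?this \<longleftrightarrow> bij_betw (\<lambda>rc. Y $$ rc) ({0..<2} \<times> {0..<m}) {1..2 * m}"
    by (rule bij_betw_cong) (simp add: Y_eq)
  finally show ?thesis
    using Y by (simp add: col_puzzles_def)
qed

lemma F2_col_puzzles: "X \<in> col_puzzles m \<Longrightarrow> F2 X \<in> col_puzzles m"
  by (rule col_puzzles_reindex[where \<sigma> = "\<lambda>(r, c). (1 - r, c)"])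
    (auto simp: F2_index[of _ m] col_puzzles_carrier F2_carrier
      intro!: bij_betw_byWitness[where f' = "\<lambda>(r, c). (1 - r, c)"])

lemma rev_cols_col_puzzles: "X \<in> col_puzzles m \<Longrightarrow> rev_cols X \<in> col_puzzles m"
  by (rule col_puzzles_reindex[where \<sigma> = "\<lambda>(r, c). (r, m - 1 - c)"])
    (auto simp: rev_cols_index[of _ 2 m] col_puzzles_carrier rev_cols_carrier
      intro!: bij_betw_byWitness[where f' = "\<lambda>(r, c). (r, m - 1 - c)"])

lemma reduction_F2:
  assumes "M \<in> carrier_mat 2 2"
  shows "reduction (F2 M) = F2 (reduction M)"
proof -
  have "elements_mat (F2 M) = elements_mat M"
    using assms F2_carrier[OF assms] by (auto simp: elements_mat_2_2 F2_index[OF assms])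
  then show ?thesis
    using assms F2_carrier[OF assms]
    by (intro eq_matI) (auto simp: reduction_def F2_def mat_swaprows_def)
qed

lemma reduction_rev_cols:
  assumes "M \<in> carrier_mat 2 2"
  shows "reduction (rev_cols M) = rev_cols (reduction M)"
proof -
  have "elements_mat (rev_cols M) = elements_mat M"
    using assms rev_cols_carrier[OF assms]
    by (auto simp: elements_mat_2_2 rev_cols_index[OF assms])
  then show ?thesis
    using assms rev_cols_carrier[OF assms]
    by (intro eq_matI) (auto simp: reduction_def rev_cols_def)
qed

lemma piece_at_F2:
  "X \<in> carrier_mat 2 m \<Longrightarrow> c + 1 < m \<Longrightarrow> piece_at (F2 X) c = F2 (piece_at X c)"
  using piece_at_carrier[of X c]
  by (intro eq_matI) (auto simp: piece_at_def F2_def mat_swaprows_def)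

text \<open>Columns \<open>c\<close> and \<open>c + 1\<close> of the reversal are columns
  \<open>m - 1 - c\<close> and \<open>m - 2 - c\<close> of \<open>X\<close>, so the piece of
  \<open>X\<close> starts at the latter.\<close>

lemma piece_at_rev_cols:
  "X \<in> carrier_mat 2 m \<Longrightarrow> c + 1 < m \<Longrightarrow>
    piece_at (rev_cols X) c = rev_cols (piece_at X (m - 2 - c))"
  by (intro eq_matI) (auto simp: piece_at_def rev_cols_def less_2_cases_iff intro!: arg_cong[where f = "\<lambda>c. X $$ (_, c)"])

lemma mem_F2_image:
  assumes "P \<subseteq> carrier_mat 2 2" "M \<in> carrier_mat 2 2"
  shows "F2 M \<in> F2 ` P \<longleftrightarrow> M \<in> P"
  using assms F2_F2 by (metis (no_types, lifting) image_iff subsetD)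

lemma mem_F1_image:
  assumes "P \<subseteq> carrier_mat 2 2" "M \<in> carrier_mat 2 2"
  shows "rev_cols M \<in> F1 ` P \<longleftrightarrow> M \<in> P"
  using assms rev_cols_rev_cols F1_eq_rev_cols by (metis (no_types, lifting) image_iff subsetD)

lemma standard_pieces_carrier: "P \<subseteq> standard_pieces \<Longrightarrow> P \<subseteq> carrier_mat 2 2"
  unfolding standard_pieces_eq by (auto dest: col_puzzles_carrier)

lemma F1_standard_pieces: "M \<in> standard_pieces \<Longrightarrow> F1 M \<in> standard_pieces"
  unfolding standard_pieces_eq
  by (simp add: F1_eq_rev_cols col_puzzles_carrier rev_cols_col_puzzles)

lemma F2_standard_pieces: "M \<in> standard_pieces \<Longrightarrow> F2 M \<in> standard_pieces"
  unfolding standard_pieces_eq by (rule F2_col_puzzles)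

lemma reduction_piece_F2_mem:
  assumes "P \<subseteq> standard_pieces" "X \<in> carrier_mat 2 m" "c + 1 < m"
  shows "reduction (piece_at (F2 X) c) \<in> F2 ` P \<longleftrightarrow> reduction (piece_at X c) \<in> P"
  using assms by (simp add: piece_at_F2[OF assms(2,3)] reduction_F2 piece_at_carrier
      mem_F2_image standard_pieces_carrier reduction_carrier)

lemma reduction_piece_rev_cols_mem:
  assumes "P \<subseteq> standard_pieces" "X \<in> carrier_mat 2 m" "c + 1 < m"
  shows "reduction (piece_at (rev_cols X) c) \<in> F1 ` P \<longleftrightarrow> reduction (piece_at X (m - 2 - c)) \<in> P"
  using assms by (simp add: piece_at_rev_cols[OF assms(2,3)] reduction_rev_cols piece_at_carrier
      mem_F1_image standard_pieces_carrier reduction_carrier)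

lemma is_support_F2:
  assumes "P \<subseteq> standard_pieces" "X \<in> carrier_mat 2 m"
  shows "is_support (F2 ` P) (F2 X) \<longleftrightarrow> is_support P X"
  using assms F2_carrier[OF assms(2)] reduction_piece_F2_mem[OF assms]
  by (auto simp: is_support_def F2_standard_pieces)

lemma is_support_rev_cols:
  assumes "P \<subseteq> standard_pieces" "X \<in> carrier_mat 2 m"
  shows "is_support (F1 ` P) (rev_cols X) \<longleftrightarrow> is_support P X"
proof -
  have "(\<forall>c. c + 1 < m \<longrightarrow> reduction (piece_at X (m - 2 - c)) \<in> P) \<longleftrightarrow>
      (\<forall>c. c + 1 < m \<longrightarrow> reduction (piece_at X c) \<in> P)" (is "?l = ?r")
  proof
    assume ?l
    show ?r
    proof (intro allI impI)
      fix c
      assume "c + 1 < m"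
      \<comment> \<open>Reflection is an involution of the piece indices; \<open>c + 1 < m\<close>
        keeps the subtractions exact.\<close>
      then have "m - 2 - (m - 2 - c) = c" "m - 2 - c + 1 < m" by auto
      with \<open>?l\<close> show "reduction (piece_at X c) \<in> P" by metis
    qed
  qed auto
  then show ?thesis
    using assms rev_cols_carrier[OF assms(2)] reduction_piece_rev_cols_mem[OF assms]
    by (auto simp: is_support_def F1_standard_pieces)
qed

text \<open>The involution acts on all standard puzzles and is therefore its own inverse between the
  two counted sets.\<close>

lemma snum_involution:
  assumes cp: "\<And>X. X \<in> standard_puzzles n \<Longrightarrow> \<phi> X \<in> standard_puzzles n \<and> \<phi> (\<phi> X) = X"
    and supp: "\<And>X. X \<in> standard_puzzles n \<Longrightarrow> is_support P' (\<phi> X) \<longleftrightarrow> is_support P X"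
  shows "snum n P' = snum n P"
proof -
  have "bij_betw \<phi> (Sset n P) (Sset n P')"
    using cp supp by (intro bij_betw_byWitness[where f' = \<phi>]) (force simp: Sset_def)+
  then show ?thesis
    by (simp add: snum_def bij_betw_same_card)
qed

lemma snum_F2: "P \<subseteq> standard_pieces \<Longrightarrow> snum n (F2 ` P) = snum n P"
  by (rule snum_involution[where \<phi> = F2])
    (auto simp: standard_puzzles_def F2_F2[OF col_puzzles_carrier] F2_col_puzzles
      is_support_F2[OF _ col_puzzles_carrier])

lemma snum_F1: "P \<subseteq> standard_pieces \<Longrightarrow> snum n (F1 ` P) = snum n P"
  by (rule snum_involution[where \<phi> = rev_cols])
    (auto simp: standard_puzzles_def rev_cols_rev_cols[OF col_puzzles_carrier] rev_cols_col_puzzles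
      is_support_rev_cols[OF _ col_puzzles_carrier])

section \<open>Cutting a puzzle in two\<close>

text \<open>For standard \<open>L\<close>, \<open>R\<close> and a word with matching letter counts,
  value \<open>v\<close> goes to the left part when the \<open>v\<close>-th letter is
  \<open>True\<close>. An entry of \<open>L\<close> or \<open>R\<close> is a rank inside its part,
  and \<open>pos\<close> gives the value of that rank.\<close>

definition glue :: "bool list \<Rightarrow> nat mat \<Rightarrow> nat mat \<Rightarrow> nat mat" where
  "glue w L R = mat 2 (dim_col L + dim_col R) (\<lambda>(r, c).
     if c < dim_col L then pos True (L $$ (r, c)) w else pos False (R $$ (r, c - dim_col L)) w)"

lemma glue_carrier:
  "L \<in> carrier_mat 2 m \<Longrightarrow> R \<in> carrier_mat 2 p \<Longrightarrow> glue w L R \<in> carrier_mat 2 (m + p)"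
  by (simp add: glue_def)

lemma glue_left:
  "L \<in> carrier_mat 2 m \<Longrightarrow> r < 2 \<Longrightarrow> c < m \<Longrightarrow> glue w L R $$ (r, c) = pos True (L $$ (r, c)) w"
  by (simp add: glue_def)

lemma glue_right:
  "L \<in> carrier_mat 2 m \<Longrightarrow> R \<in> carrier_mat 2 p \<Longrightarrow> r < 2 \<Longrightarrow> c < p \<Longrightarrow>
    glue w L R $$ (r, m + c) = pos False (R $$ (r, c)) w"
  by (simp add: glue_def)

lemma glue_left_bij:
  assumes L: "L \<in> col_puzzles m" and w: "w \<in> words True (2 * m) t"
  shows "bij_betw (\<lambda>rc. glue w L R $$ rc) ({0..<2} \<times> {0..<m}) {v \<in> {1..length w}. w ! (v - 1)}"
proof -
  have "bij_betw ((\<lambda>k. pos True k w) \<circ> (\<lambda>rc. L $$ rc)) ({0..<2} \<times> {0..<m})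
      {v \<in> {1..length w}. w ! (v - 1)}"
    using L w pos_bij[of True w]
    by (rule_tac bij_betw_trans[of _ _ "{1..2 * m}"]) (auto simp: col_puzzles_def words_def)
  also have "?this \<longleftrightarrow> ?thesis"
    using col_puzzles_carrier[OF L] by (intro bij_betw_cong) (auto simp: glue_left)
  finally show ?thesis .
qed

lemma glue_right_bij:
  assumes L: "L \<in> col_puzzles m" and R: "R \<in> col_puzzles p" and w: "w \<in> words True s (2 * p)"
  shows "bij_betw (\<lambda>rc. glue w L R $$ rc) ({0..<2} \<times> {m..<m + p}) {v \<in> {1..length w}. \<not> w ! (v - 1)}"
proof -
  have shift: "bij_betw (\<lambda>(r, c). (r, c - m)) ({0..<2::nat} \<times> {m..<m + p}) ({0..<2} \<times> {0..<p})"
    by (rule bij_betw_byWitness[where f' = "\<lambda>(r, c). (r, m + c)"]) auto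
  have "bij_betw ((\<lambda>k. pos False k w) \<circ> (\<lambda>rc. R $$ rc)) ({0..<2} \<times> {0..<p})
      {v \<in> {1..length w}. \<not> w ! (v - 1)}"
    using R w pos_bij[of False w]
    by (rule_tac bij_betw_trans[of _ _ "{1..2 * p}"]) (auto simp: col_puzzles_def words_def)
  from bij_betw_trans[OF shift this]
  have "bij_betw ((\<lambda>k. pos False k w) \<circ> (\<lambda>rc. R $$ rc) \<circ> (\<lambda>(r, c). (r, c - m)))
      ({0..<2} \<times> {m..<m + p}) {v \<in> {1..length w}. \<not> w ! (v - 1)}" .
  also have "?this \<longleftrightarrow> ?thesis"
    using col_puzzles_carrier[OF L] col_puzzles_carrier[OF R]
    by (intro bij_betw_cong) (auto simp: glue_def)
  finally show ?thesis .
qed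

lemma glue_col_puzzles:
  assumes L: "L \<in> col_puzzles m" and R: "R \<in> col_puzzles p" and w: "w \<in> words True (2 * m) (2 * p)"
  shows "glue w L R \<in> col_puzzles (m + p)"
proof -
  have "{0..<2} \<times> {0..<m} \<union> {0..<2} \<times> {m..<m + p} = {0..<2::nat} \<times> {0..<m + p}"
    by auto
  moreover have "{v \<in> {1..length w}. w ! (v - 1)} \<union> {v \<in> {1..length w}. \<not> w ! (v - 1)} =
      {1..2 * (m + p)}"
    using length_words[OF w] by auto
  ultimately have "bij_betw (\<lambda>rc. glue w L R $$ rc) ({0..<2} \<times> {0..<m + p}) {1..2 * (m + p)}"
    using bij_betw_combine[OF glue_left_bij[OF L w, of R] glue_right_bij[OF L R w]] by auto
  then show ?thesis
    using glue_carrier[OF col_puzzles_carrier[OF L] col_puzzles_carrier[OF R]]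
    by (simp add: col_puzzles_def)
qed

lemma pos_inj:
  assumes "1 \<le> i" "i \<le> count_list w c" "1 \<le> k" "k \<le> count_list w c" "pos c i w = pos c k w"
  shows "i = k"
  using pos_less[of i k w c] pos_less[of k i w c] assms by (cases i k rule: linorder_cases) auto

text \<open>The values in the first \<open>m\<close> columns recover the word; then
  \<open>pos\<close> is injective on the ranks of either part.\<close>

lemma glue_inj:
  assumes L: "L \<in> col_puzzles m" "L' \<in> col_puzzles m" and R: "R \<in> col_puzzles p" "R' \<in> col_puzzles p"
    and w: "w \<in> words True (2 * m) (2 * p)" "w' \<in> words True (2 * m) (2 * p)"
    and eq: "glue w L R = glue w' L' R'"
  shows "w = w' \<and> L = L' \<and> R = R'"
proof -
  have len: "length w = length w'"
    using w[THEN length_words] by simp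
  have "{v \<in> {1..length w}. w ! (v - 1)} = {v \<in> {1..length w'}. w' ! (v - 1)}"
    using glue_left_bij[OF L(1) w(1), of R] glue_left_bij[OF L(2) w(2), of R']
    unfolding eq bij_betw_def by simp
  then have "Suc i \<in> {v \<in> {1..length w}. w ! (v - 1)} \<longleftrightarrow>
      Suc i \<in> {v \<in> {1..length w'}. w' ! (v - 1)}" for i
    by simp
  then have "w ! i \<longleftrightarrow> w' ! i" if "i < length w" for i
    using that len by (simp add: Suc_le_eq) blast
  then have w_eq: "w = w'"
    using len by (intro nth_equalityI)
  note C = L[THEN col_puzzles_carrier] R[THEN col_puzzles_carrier]
  have "L = L'"
  proof (rule eq_matI)
    fix r c
    assume "r < dim_row L'" "c < dim_col L'"
    then have rc: "r < 2" "c < m" using C by auto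
    then have "pos True (L $$ (r, c)) w = pos True (L' $$ (r, c)) w"
      using glue_left[OF C(1) rc, of w R] glue_left[OF C(2) rc, of w' R'] eq w_eq
      by metis
    moreover have "L $$ (r, c) \<in> {1..2 * m}" "L' $$ (r, c) \<in> {1..2 * m}"
      using L rc by (simp_all only: col_puzzles_range)
    ultimately show "L $$ (r, c) = L' $$ (r, c)"
      using w(1) by (intro pos_inj[of "L $$ (r, c)" w True]) (simp_all add: words_def)
  qed (use C in auto)
  moreover have "R = R'"
  proof (rule eq_matI)
    fix r c
    assume "r < dim_row R'" "c < dim_col R'"
    then have rc: "r < 2" "c < p" using C by auto
    then have "pos False (R $$ (r, c)) w = pos False (R' $$ (r, c)) w"
      using glue_right[OF C(1) C(3) rc, of w] glue_right[OF C(2) C(4) rc, of w'] eq w_eq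
      by metis
    moreover have "R $$ (r, c) \<in> {1..2 * p}" "R' $$ (r, c) \<in> {1..2 * p}"
      using R rc by (simp_all only: col_puzzles_range)
    ultimately show "R $$ (r, c) = R' $$ (r, c)"
      using w(1) by (intro pos_inj[of "R $$ (r, c)" w False]) (simp_all add: words_def)
  qed (use C in auto)
  ultimately show ?thesis using w_eq by simp
qed

lemma glue_surj:
  assumes X: "X \<in> col_puzzles (m + p)"
  obtains w L R where "X = glue w L R" "w \<in> words True (2 * m) (2 * p)"
    "L \<in> col_puzzles m" "R \<in> col_puzzles p"
proof -
  let ?l = "{0..<2} \<times> {0..<m} :: (nat \<times> nat) set"
  let ?r = "{0..<2} \<times> {m..<m + p} :: (nat \<times> nat) set"
  let ?f = "\<lambda>rc. X $$ rc"
  \<comment> \<open>The letter for value \<open>v\<close> has list index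
    \<open>v - 1\<close>.\<close>
  define w where "w = map (\<lambda>v. v \<in> ?f ` ?l) [1..<Suc (2 * (m + p))]"
  have len: "length w = 2 * (m + p)"
    by (simp add: w_def del: upt_Suc)
  have nth: "w ! (v - 1) \<longleftrightarrow> v \<in> ?f ` ?l" if "v \<in> {1..length w}" for v
    using that unfolding w_def by (auto simp del: upt_Suc)
  have bij: "bij_betw ?f (?l \<union> ?r) {1..2 * (m + p)}"
  proof -
    have "?l \<union> ?r = {0..<2} \<times> {0..<m + p}" by auto
    with X show ?thesis by (simp add: col_puzzles_def)
  qed
  have range: "?f ` (?l \<union> ?r) = {1..length w}"
    using bij len by (simp add: bij_betw_def)
  have left: "bij_betw ?f ?l {v \<in> {1..length w}. w ! (v - 1) = True}"
  proof -
    have "{v \<in> {1..length w}. w ! (v - 1) = True} = ?f ` ?l"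
      using nth range by (simp only: eq_True) blast
    then show ?thesis
      using bij_betw_subset[OF bij] by auto
  qed
  have right: "bij_betw ?f ?r {v \<in> {1..length w}. w ! (v - 1) = False}"
  proof -
    have "{v \<in> {1..length w}. w ! (v - 1) = False} = ?f ` (?l \<union> ?r) - ?f ` ?l"
      using nth range by (simp only: eq_False) blast
    also have "\<dots> = ?f ` (?l \<union> ?r - ?l)"
      using bij by (intro inj_on_image_set_diff[symmetric]) (auto simp: bij_betw_def)
    also have "?l \<union> ?r - ?l = ?r" by auto
    finally show ?thesis
      using bij_betw_subset[OF bij, of ?r] by auto
  qed
  \<comment> \<open>Each letter occurs as often as its block has cells: \<open>pos\<close> and the
    entries of the block map bijectively onto the same values.\<close>
  have "count_list w True = 2 * m" "count_list w False = 2 * p"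
    using bij_betw_same_card[OF pos_bij[of True w]] bij_betw_same_card[OF left]
      bij_betw_same_card[OF pos_bij[of False w]] bij_betw_same_card[OF right]
    by simp_all
  then have w: "w \<in> words True (2 * m) (2 * p)"
    by (simp add: words_def)
  \<comment> \<open>\<open>rank c\<close> inverts \<open>pos c\<close>: it sends a value to its rank
    inside its own part.\<close>
  define rank where "rank c = inv_into {1..count_list w c} (\<lambda>k. pos c k w)" for c
  have rank: "bij_betw (rank c) {v \<in> {1..length w}. w ! (v - 1) = c} {1..count_list w c}" for c
    unfolding rank_def by (rule bij_betw_inv_into[OF pos_bij])
  have pos_rank: "pos c (rank c v) w = v" if "v \<in> {v \<in> {1..length w}. w ! (v - 1) = c}" for c v
    unfolding rank_def using bij_betw_inv_into_right[OF pos_bij that] .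
  define L where "L = mat 2 m (\<lambda>rc. rank True (X $$ rc))"
  define R where "R = mat 2 p (\<lambda>(r, c). rank False (X $$ (r, m + c)))"
  have "L \<in> col_puzzles m"
  proof -
    have "bij_betw (rank True \<circ> ?f) ?l {1..2 * m}"
      using bij_betw_trans[OF left rank] \<open>count_list w True = 2 * m\<close> by simp
    also have "?this \<longleftrightarrow> bij_betw (\<lambda>rc. L $$ rc) ?l {1..2 * m}"
      by (rule bij_betw_cong) (auto simp: L_def)
    finally show ?thesis
      by (simp add: col_puzzles_def L_def)
  qed
  moreover have "R \<in> col_puzzles p"
  proof -
    have "bij_betw (\<lambda>(r, c). (r, m + c)) ({0..<2::nat} \<times> {0..<p}) ?r"
      by (rule bij_betw_byWitness[where f' = "\<lambda>(r, c). (r, c - m)"]) auto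
    then have "bij_betw (rank False \<circ> ?f \<circ> (\<lambda>(r, c). (r, m + c))) ({0..<2} \<times> {0..<p}) {1..2 * p}"
      using bij_betw_trans[OF right rank] \<open>count_list w False = 2 * p\<close>
      by (rule_tac bij_betw_trans[of _ _ ?r]) simp_all
    also have "?this \<longleftrightarrow> bij_betw (\<lambda>rc. R $$ rc) ({0..<2} \<times> {0..<p}) {1..2 * p}"
      by (rule bij_betw_cong) (auto simp: R_def)
    finally show ?thesis
      by (simp add: col_puzzles_def R_def)
  qed
  moreover have "X = glue w L R"
  proof (rule eq_matI)
    fix r c
    assume "r < dim_row (glue w L R)" "c < dim_col (glue w L R)"
    then have rc: "r < 2" "c < m + p"
      by (auto simp: glue_def L_def R_def)
    show "X $$ (r, c) = glue w L R $$ (r, c)"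
    proof (cases "c < m")
      case True
      with rc have "X $$ (r, c) \<in> {v \<in> {1..length w}. w ! (v - 1) = True}"
        by (intro bij_betw_apply[OF left]) auto
      from pos_rank[OF this] rc True show ?thesis by (simp add: glue_def L_def R_def)
    next
      case False
      with rc have "X $$ (r, c) \<in> {v \<in> {1..length w}. w ! (v - 1) = False}"
        by (intro bij_betw_apply[OF right]) auto
      from pos_rank[OF this] rc False show ?thesis by (simp add: glue_def L_def R_def)
    qed
  qed (use col_puzzles_carrier[OF X] in \<open>auto simp: glue_def L_def R_def\<close>)
  ultimately show thesis using w that by blast
qed

lemma reduction_glue_left:
  assumes L: "L \<in> col_puzzles m" and w: "w \<in> words True (2 * m) t" and c: "c + 1 < m"
  shows "reduction (piece_at (glue w L R) c) = reduction (piece_at L c)"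
proof -
  have "piece_at (glue w L R) c = map_mat (\<lambda>k. pos True k w) (piece_at L c)"
    using c glue_left[OF col_puzzles_carrier[OF L]]
    by (intro eq_matI) (auto simp: piece_at_def)
  moreover have "elements_mat (piece_at L c) \<subseteq> {1..count_list w True}"
    using c col_puzzles_range[OF L] w by (auto simp: elements_mat_def piece_at_def words_def)
  ultimately show ?thesis
    using reduction_map_mat[OF monotone_on_subset[OF pos_mono_on]] by simp
qed

lemma reduction_glue_right:
  assumes L: "L \<in> col_puzzles m" and R: "R \<in> col_puzzles p" and w: "w \<in> words True s (2 * p)"
    and c: "c + 1 < p"
  shows "reduction (piece_at (glue w L R) (m + c)) = reduction (piece_at R c)"
proof -
  have "piece_at (glue w L R) (m + c) = map_mat (\<lambda>k. pos False k w) (piece_at R c)"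
    using c glue_right[OF L[THEN col_puzzles_carrier] R[THEN col_puzzles_carrier]]
    by (intro eq_matI) (auto simp: piece_at_def add.assoc)
  moreover have "elements_mat (piece_at R c) \<subseteq> {1..count_list w False}"
    using c col_puzzles_range[OF R] w by (auto simp: elements_mat_def piece_at_def words_def)
  ultimately show ?thesis
    using reduction_map_mat[OF monotone_on_subset[OF pos_mono_on]] by simp
qed

section \<open>Counting\<close>

definition up :: "nat mat \<Rightarrow> nat \<Rightarrow> bool" where
  "up X c \<longleftrightarrow> X $$ (1, c) < X $$ (0, c)"

definition join_puzzles :: "bool list \<Rightarrow> nat mat \<Rightarrow> nat mat \<Rightarrow> nat mat" where
  "join_puzzles w L R = glue w (F2 L) (rev_cols R)"

text \<open>The right-hand pieces are images under \<open>F1\<close> alone, because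
  \<open>F1 \<circ> F2\<close> is applied to pieces whose rows are already exchanged.\<close>

definition joined_pieces :: "nat mat set \<Rightarrow> nat \<Rightarrow> nat mat set \<Rightarrow> nat mat set" where
  "joined_pieces P y Q = F2 ` P \<union> {pieceC y} \<union> F1 ` Q"

definition ending_puzzles :: "nat mat set \<Rightarrow> nat \<Rightarrow> nat \<Rightarrow> nat \<Rightarrow> nat mat set" where
  "ending_puzzles P i j m =
     {X \<in> col_puzzles m. is_support P X \<and> X $$ (1, m - 1) = i \<and> X $$ (0, m - 1) = i + j}"

section \<open>Standard pieces and their up and down columns\<close>

lemma mat_2_2_standard:
  assumes "{a, b, c, d} = {1, 2, 3, 4}"
  shows "mat_of_rows_list 2 [[a, b], [c, d]] \<in> standard_pieces" (is "?M \<in> _")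
proof -
  have I: "{0..<2} \<times> {0..<2} = ({(0, 0), (0, 1), (1, 0), (1, 1)} :: (nat \<times> nat) set)"
    by (auto simp: less_2_cases_iff)
  have "(\<lambda>rc. ?M $$ rc) ` ({0..<2} \<times> {0..<2}) = {a, b, c, d}"
    unfolding I by (simp add: mat_of_rows_list_def)
  also have "\<dots> = {1..2 * 2}"
    unfolding assms by auto
  finally have img: "(\<lambda>rc. ?M $$ rc) ` ({0..<2} \<times> {0..<2}) = {1..2 * 2}" .
  \<comment> \<open>Four cells cover four values, so no value repeats.\<close>
  have "inj_on (\<lambda>rc. ?M $$ rc) ({0..<2} \<times> {0..<2})"
    by (rule eq_card_imp_inj_on) (simp_all add: img del: mult_2)
  with img have "bij_betw (\<lambda>rc. ?M $$ rc) ({0..<2} \<times> {0..<2}) {1..2 * 2}"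
    by (rule bij_betw_imageI[rotated])
  moreover have "?M \<in> carrier_mat 2 2"
    by (rule carrier_matI) (simp_all add: mat_of_rows_list_def)
  ultimately show ?thesis
    unfolding standard_pieces_eq col_puzzles_def by blast
qed

lemma atLeastAtMost_1_6: "{1..6} = {1, 2, 3, 4, 5, 6 :: nat}"
  by auto

lemma pieceA_standard: "i \<in> {1..6} \<Longrightarrow> pieceA i \<in> standard_pieces"
  unfolding atLeastAtMost_1_6 by (auto simp: pieceA_def intro!: mat_2_2_standard)

lemma pieceB_standard: "i \<in> {1..6} \<Longrightarrow> pieceB i \<in> standard_pieces"
  unfolding atLeastAtMost_1_6 by (auto simp: pieceB_def intro!: mat_2_2_standard)

lemma pieceC_standard: "i \<in> {1..6} \<Longrightarrow> pieceC i \<in> standard_pieces"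
  using F2_standard_pieces[OF pieceB_standard] F_pieces(6) by metis

lemma pieceA_up: "i \<in> {1..6} \<Longrightarrow> d < 2 \<Longrightarrow> up (pieceA i) d"
  unfolding atLeastAtMost_1_6
  by (auto simp: up_def pieceA_def mat_of_rows_list_def less_2_cases_iff)

lemma pieceC_up: "i \<in> {1..6} \<Longrightarrow> \<not> up (pieceC i) 0 \<and> up (pieceC i) 1"
  unfolding atLeastAtMost_1_6
  by (auto simp: up_def pieceC_def pieceB_def mat_swaprows_def mat_of_rows_list_def)

lemma up_piece:
  assumes "X \<in> carrier_mat 2 m" "c + 1 < m"
  shows "up X c \<longleftrightarrow> up (reduction (piece_at X c)) 0" "up X (c + 1) \<longleftrightarrow> up (reduction (piece_at X c)) 1"
  using reduction_less_iff[OF piece_at_carrier[of X c]] by (auto simp: up_def piece_at_def)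

lemma up_F2:
  assumes "X \<in> col_puzzles m" "c < m"
  shows "up (F2 X) c \<longleftrightarrow> \<not> up X c"
proof -
  have "X $$ (0, c) \<noteq> X $$ (1, c)"
    using col_puzzles_inj[OF assms(1), of 0 c 1 c] assms(2) by auto
  then show ?thesis
    using assms F2_index[OF col_puzzles_carrier[OF assms(1)]] by (auto simp: up_def)
qed

lemma up_rev_cols: "X \<in> carrier_mat 2 m \<Longrightarrow> c < m \<Longrightarrow> up (rev_cols X) c \<longleftrightarrow> up X (m - 1 - c)"
  by (simp add: up_def rev_cols_index[of _ 2 m])

text \<open>The three kinds of pieces are told apart by the directions of their columns: down-down,
  down-up and up-up. As none is up-down, the direction changes at most once along a puzzle.\<close>

lemma mem_joined_pieces:
  assumes P: "P \<subseteq> pieceA ` {1..6}" and Q: "Q \<subseteq> pieceA ` {1..6}" and y: "y \<in> {1..6}"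
    and K: "K \<in> joined_pieces P y Q"
  shows "K \<in> F2 ` P \<longleftrightarrow> \<not> up K 1" "K = pieceC y \<longleftrightarrow> \<not> up K 0 \<and> up K 1" "K \<in> F1 ` Q \<longleftrightarrow> up K 0"
    "up K 0 \<Longrightarrow> up K 1"
proof -
  have down: "\<not> up K d" if "K \<in> F2 ` P" "d < 2" for d
  proof -
    from that P obtain i where "K = F2 (pieceA i)" "i \<in> {1..6}" by auto
    then show ?thesis
      using up_F2[of "pieceA i" 2 d] pieceA_standard[of i] pieceA_up[of i d] \<open>d < 2\<close>
      by (simp add: standard_pieces_eq)
  qed
  have up: "up K d" if "K \<in> F1 ` Q" "d < 2" for d
  proof -
    from that Q obtain i where i: "K = F1 (pieceA i)" "i \<in> {1..6}" by auto
    then have "pieceA i \<in> carrier_mat 2 2"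
      using pieceA_standard[of i] by (simp add: standard_pieces_eq col_puzzles_carrier)
    with i show ?thesis
      using up_rev_cols[of "pieceA i" 2 d] pieceA_up[of i "1 - d"] \<open>d < 2\<close>
      by (simp add: F1_eq_rev_cols)
  qed
  have "K \<in> F2 ` P \<or> K = pieceC y \<or> K \<in> F1 ` Q"
    using K by (auto simp: joined_pieces_def)
  with down[of 0] down[of 1] up[of 0] up[of 1] pieceC_up[OF y]
  show "K \<in> F2 ` P \<longleftrightarrow> \<not> up K 1" "K = pieceC y \<longleftrightarrow> \<not> up K 0 \<and> up K 1" "K \<in> F1 ` Q \<longleftrightarrow> up K 0"
    "up K 0 \<Longrightarrow> up K 1"
    by auto
qed

lemma A_pieces_standard: "P \<subseteq> pieceA ` {1..6} \<Longrightarrow> P \<subseteq> standard_pieces"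
  using pieceA_standard by blast

lemma joined_pieces_standard:
  assumes "P \<subseteq> pieceA ` {1..6}" "Q \<subseteq> pieceA ` {1..6}" "y \<in> {1..6}"
  shows "joined_pieces P y Q \<subseteq> standard_pieces"
  using assms A_pieces_standard F2_standard_pieces F1_standard_pieces pieceC_standard
  unfolding joined_pieces_def by blast

text \<open>Every column but the last is the left column of an A-piece. The direction of the last
  one is assumed on account of \<open>m = 1\<close>, where there is no piece and the single column
  may point either way.\<close>

lemma support_A_up:
  assumes "P \<subseteq> pieceA ` {1..6}" "X \<in> carrier_mat 2 m" "is_support P X" "up X (m - 1)" "c < m"
  shows "up X c"
proof (cases "c + 1 < m")
  case True
  with assms have "reduction (piece_at X c) \<in> pieceA ` {1..6}"
    by (auto simp: is_support_def)
  with up_piece(1)[OF assms(2) True] pieceA_up show ?thesis by auto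
next
  case False
  with assms(5) have "c = m - 1" by simp
  with assms(4) show ?thesis by simp
qed

section \<open>Joining two puzzles along a word\<close>

lemma join_col_puzzles:
  "L \<in> col_puzzles m \<Longrightarrow> R \<in> col_puzzles p \<Longrightarrow> w \<in> words True (2 * m) (2 * p) \<Longrightarrow>
    join_puzzles w L R \<in> col_puzzles (m + p)"
  unfolding join_puzzles_def by (intro glue_col_puzzles F2_col_puzzles rev_cols_col_puzzles)

lemma join_index_left:
  assumes "L \<in> col_puzzles m" "r < 2" "c < m"
  shows "join_puzzles w L R $$ (r, c) = pos True (L $$ (1 - r, c)) w"
  using assms unfolding join_puzzles_def
  by (simp add: glue_left[of _ m] F2_carrier F2_index[of _ m] col_puzzles_carrier)

lemma join_index_right:
  assumes "L \<in> col_puzzles m" "R \<in> col_puzzles p" "r < 2" "c < p"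
  shows "join_puzzles w L R $$ (r, m + c) = pos False (R $$ (r, p - 1 - c)) w"
  using assms glue_right[of "F2 L" m "rev_cols R" p r c w] unfolding join_puzzles_def
  by (simp add: F2_carrier rev_cols_carrier rev_cols_index[of _ 2 p] col_puzzles_carrier)

lemma pos_less_iff:
  assumes "i \<in> {1..count_list w c}" "k \<in> {1..count_list w c}"
  shows "pos c i w < pos c k w \<longleftrightarrow> i < k"
  using strict_mono_on_less[OF pos_mono_on assms] by simp

lemma up_join_left:
  assumes "L \<in> col_puzzles m" "w \<in> words True (2 * m) t" "c < m"
  shows "up (join_puzzles w L R) c \<longleftrightarrow> \<not> up L c"
proof -
  have "up (join_puzzles w L R) c \<longleftrightarrow> L $$ (0, c) < L $$ (1, c)"
    using assms pos_less_iff[of "L $$ (0, c)" w True "L $$ (1, c)"]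
      col_puzzles_range[OF assms(1), of 0 c] col_puzzles_range[OF assms(1), of 1 c]
    by (simp add: up_def join_index_left words_def)
  with up_F2[OF assms(1,3)] F2_index[OF col_puzzles_carrier[OF assms(1)]] assms(3)
  show ?thesis by (simp add: up_def)
qed

lemma up_join_right:
  assumes "L \<in> col_puzzles m" "R \<in> col_puzzles p" "w \<in> words True s (2 * p)" "c < p"
  shows "up (join_puzzles w L R) (m + c) \<longleftrightarrow> up R (p - 1 - c)"
  using assms pos_less_iff[of "R $$ (1, p - 1 - c)" w False "R $$ (0, p - 1 - c)"]
    col_puzzles_range[OF assms(2), of 0 "p - 1 - c"] col_puzzles_range[OF assms(2), of 1 "p - 1 - c"]
  by (simp add: up_def join_index_right words_def)

lemma reduction_join_left:
  assumes "P \<subseteq> standard_pieces" "L \<in> col_puzzles m" "w \<in> words True (2 * m) t" "c + 1 < m"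
  shows "reduction (piece_at (join_puzzles w L R) c) \<in> F2 ` P \<longleftrightarrow> reduction (piece_at L c) \<in> P"
  using assms reduction_glue_left[OF F2_col_puzzles[OF assms(2)] assms(3,4)]
    reduction_piece_F2_mem[OF assms(1) col_puzzles_carrier[OF assms(2)] assms(4)]
  by (simp add: join_puzzles_def)

lemma reduction_join_right:
  assumes "Q \<subseteq> standard_pieces" "L \<in> col_puzzles m" "R \<in> col_puzzles p"
    and "w \<in> words True s (2 * p)" "c + 1 < p"
  shows "reduction (piece_at (join_puzzles w L R) (m + c)) \<in> F1 ` Q \<longleftrightarrow>
    reduction (piece_at R (p - 2 - c)) \<in> Q"
  using assms reduction_glue_right[OF F2_col_puzzles[OF assms(2)] rev_cols_col_puzzles[OF assms(3)] assms(4,5)]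
    reduction_piece_rev_cols_mem[OF assms(1) col_puzzles_carrier[OF assms(3)] assms(5)]
  by (simp add: join_puzzles_def)

text \<open>Two chains \<open>a < c\<close> and \<open>d < b\<close> of distinct entries interleave
  in (4 choose 2) = 6 ways, and each is the order of exactly one C_y. Together with the chains, the
  listed comparisons fix the interleaving.\<close>

lemma reduction_eq_pieceC:
  fixes a b c d :: nat
  assumes M: "M \<in> carrier_mat 2 2" "M $$ (0, 0) = a" "M $$ (0, 1) = b" "M $$ (1, 0) = c"
      "M $$ (1, 1) = d"
    and y: "y \<in> {1..6}"
    and less: "a < c" "d < b" and neq: "a \<noteq> d" "a \<noteq> b" "c \<noteq> d" "c \<noteq> b"
  shows "reduction M = pieceC y \<longleftrightarrow>
    (if y = 1 then a < d \<and> b < c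
     else if y = 2 then a < d \<and> d < c \<and> c < b
     else if y = 3 then c < d
     else if y = 4 then d < a \<and> c < b
     else if y = 5 then d < a \<and> a < b \<and> b < c
     else b < a)"
proof -
  have all2: "(\<forall>r<2. A r) \<longleftrightarrow> A 0 \<and> A 1" for A :: "nat \<Rightarrow> bool"
    by (auto simp: less_2_cases_iff)
  have "y = 1 \<or> y = 2 \<or> y = 3 \<or> y = 4 \<or> y = 5 \<or> y = 6"
    using y by auto
  then show ?thesis
    unfolding reduction_eq_iff[OF M(1) pieceC_standard[OF y]] all2 M(2-5)
    by (elim disjE; 
        simp add: pieceC_def pieceB_def mat_swaprows_def mat_of_rows_list_def;
        insert less neq; safe; linarith)
qed

lemma reduction_join_middle:
  assumes L: "L \<in> col_puzzles m" and R: "R \<in> col_puzzles p" and w: "w \<in> words True (2 * m) (2 * p)"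
    and mp: "1 \<le> m" "1 \<le> p" and y: "y \<in> {1..6}"
    and ij: "L $$ (1, m - 1) = i" "L $$ (0, m - 1) = i + j" "1 \<le> j"
    and kl: "R $$ (1, p - 1) = k" "R $$ (0, p - 1) = k + l" "1 \<le> l"
  shows "reduction (piece_at (join_puzzles w L R) (m - 1)) = pieceC y \<longleftrightarrow> fits y i j k l w"
proof -
  let ?M = "piece_at (join_puzzles w L R) (m - 1)"
  have M: "?M $$ (0, 0) = pos True i w" "?M $$ (1, 0) = pos True (i + j) w"
    "?M $$ (0, 1) = pos False (k + l) w" "?M $$ (1, 1) = pos False k w"
    using join_index_left[OF L, of _ "m - 1" w R] join_index_right[OF L R, of _ 0 w] mp ij kl
    by (simp_all add: piece_at_def)
  have cnt: "i \<in> {1..count_list w True}" "i + j \<in> {1..count_list w True}"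
    "k \<in> {1..count_list w False}" "k + l \<in> {1..count_list w False}"
    using col_puzzles_range[OF L, of 1 "m - 1"] col_puzzles_range[OF L, of 0 "m - 1"]
      col_puzzles_range[OF R, of 1 "p - 1"] col_puzzles_range[OF R, of 0 "p - 1"] mp ij kl w
    by (auto simp: words_def)
  have less: "pos True i w < pos True (i + j) w" "pos False k w < pos False (k + l) w"
    using pos_less_iff[OF cnt(1,2)] pos_less_iff[OF cnt(3,4)] ij(3) kl(3) by auto
  \<comment> \<open>A position carries one letter only, so entries of different parts never
    coincide.\<close>
  have neq: "pos True a w \<noteq> pos False b w"
    if "a \<in> {1..count_list w True}" "b \<in> {1..count_list w False}" for a b
    using bij_betw_apply[OF pos_bij that(1)] bij_betw_apply[OF pos_bij that(2)] by auto
  note neqs = neq[OF cnt(1,3)] neq[OF cnt(1,4)] neq[OF cnt(2,3)] neq[OF cnt(2,4)]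
  show ?thesis
    using reduction_eq_pieceC[OF piece_at_carrier M(1) M(3) M(2) M(4) y less neqs(1,2,3,4)]
    by (simp add: fits_def Let_def)
qed

text \<open>The direction pattern ties the cut at \<open>m\<close> to the puzzle. Given it, each
  piece falls by its columns into one of the three kinds, and these translate separately into
  conditions on \<open>L\<close>, on \<open>R\<close> and on the middle piece. Conversely, the
  directions of the last columns of \<open>L\<close> and \<open>R\<close> spread to all their
  columns.\<close>

lemma join_support_iff:
  assumes P: "P \<subseteq> pieceA ` {1..6}" and Q: "Q \<subseteq> pieceA ` {1..6}" and y: "y \<in> {1..6}"
    and L: "L \<in> col_puzzles m" and R: "R \<in> col_puzzles p" and w: "w \<in> words True (2 * m) (2 * p)"
    and mp: "1 \<le> m" "1 \<le> p"
  shows "is_support (joined_pieces P y Q) (join_puzzles w L R) \<and>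
      (\<forall>c<m + p. up (join_puzzles w L R) c \<longleftrightarrow> m \<le> c) \<longleftrightarrow>
    is_support P L \<and> up L (m - 1) \<and> is_support Q R \<and> up R (p - 1) \<and>
      reduction (piece_at (join_puzzles w L R) (m - 1)) = pieceC y" (is "?lhs \<longleftrightarrow> ?rhs")
proof -
  let ?X = "join_puzzles w L R"
  let ?S = "joined_pieces P y Q"
  have X: "?X \<in> carrier_mat 2 (m + p)"
    using join_col_puzzles[OF L R w] by (rule col_puzzles_carrier)
  note carrier = col_puzzles_carrier[OF L] col_puzzles_carrier[OF R]
  note PQ = A_pieces_standard[OF P] A_pieces_standard[OF Q]
  note mem = mem_joined_pieces[OF P Q y]
  show ?thesis
  proof
    assume lhs: ?lhs
    then have S: "reduction (piece_at ?X c) \<in> ?S" if "c + 1 < m + p" for c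
      using that X by (auto simp: is_support_def)
    have ups: "up ?X c \<longleftrightarrow> m \<le> c" if "c < m + p" for c
      using lhs that by simp
    have "reduction (piece_at L c) \<in> P" if c: "c + 1 < m" for c
    proof -
      have "\<not> up ?X (c + 1)" using ups[of "c + 1"] c by simp
      then have "reduction (piece_at ?X c) \<in> F2 ` P"
        using mem(1)[OF S[of c]] up_piece(2)[OF X, of c] c by simp
      then show ?thesis
        using reduction_join_left[OF PQ(1) L w c] by simp
    qed
    then have 1: "is_support P L"
      using PQ carrier by (simp add: is_support_def)
    have "reduction (piece_at R c) \<in> Q" if c: "c + 1 < p" for c
    proof -
      \<comment> \<open>Piece \<open>c\<close> of \<open>R\<close> appears, reversed, as piece
        \<open>m + (p - 2 - c)\<close> of the joined puzzle.\<close>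
      let ?c = "p - 2 - c"
      have c': "?c + 1 < p" "p - 2 - ?c = c" using c by auto
      then have "up ?X (m + ?c)" using ups[of "m + ?c"] by simp
      then have "reduction (piece_at ?X (m + ?c)) \<in> F1 ` Q"
        using mem(3)[OF S[of "m + ?c"]] up_piece(1)[OF X, of "m + ?c"] c' by simp
      then show ?thesis
        using reduction_join_right[OF PQ(2) L R w c'(1)] c'(2) by simp
    qed
    then have 2: "is_support Q R"
      using PQ carrier by (simp add: is_support_def)
    have "m - 1 < m" "m - 1 < m + p" "\<not> m \<le> m - 1"
      using mp by auto
    then have 3: "up L (m - 1)"
      using up_join_left[OF L w, of "m - 1" R] ups[of "m - 1"] by blast
    have 4: "up R (p - 1)"
      using up_join_right[OF L R w, of 0] ups[of m] mp by simp
    have "reduction (piece_at ?X (m - 1)) = pieceC y"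
      using mem(2)[OF S[of "m - 1"]] up_piece[OF X, of "m - 1"] ups[of "m - 1"] ups[of m] mp by simp
    with 1 2 3 4 show ?rhs by simp
  next
    assume rhs: ?rhs
    have "up ?X c \<longleftrightarrow> m \<le> c" if c: "c < m + p" for c
    proof (cases "c < m")
      case True
      then show ?thesis
        using up_join_left[OF L w True] support_A_up[OF P carrier(1) _ _ True] rhs by simp
    next
      case False
      with c have "c - m < p" "m + (c - m) = c" by auto
      then show ?thesis
        using up_join_right[OF L R w, of "c - m"] support_A_up[OF Q carrier(2), of "p - 1 - (c - m)"]
          rhs False by simp
    qed
    moreover have "reduction (piece_at ?X c) \<in> ?S" if c: "c + 1 < m + p" for c
    proof -
      consider "c + 1 < m" | "c = m - 1" | "m \<le> c" by linarith
      then show ?thesis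
      proof cases
        case 1
        then have "reduction (piece_at ?X c) \<in> F2 ` P"
          using reduction_join_left[OF PQ(1) L w 1] rhs carrier by (simp add: is_support_def)
        then show ?thesis by (simp add: joined_pieces_def)
      next
        case 2
        with rhs show ?thesis by (simp add: joined_pieces_def)
      next
        case 3
        with c have c': "c - m + 1 < p" "m + (c - m) = c" by auto
        then have "p - 2 - (c - m) + 1 < p" by auto
        then have "reduction (piece_at ?X c) \<in> F1 ` Q"
          using reduction_join_right[OF PQ(2) L R w c'(1)] c'(2) rhs carrier
          by (simp add: is_support_def)
        then show ?thesis by (simp add: joined_pieces_def)
      qed
    qed
    ultimately show ?lhs
      using X joined_pieces_standard[OF P Q y] by (simp add: is_support_def)
  qed
qed

lemma finite_col_puzzles: "finite (col_puzzles m)"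
proof (rule finite_subset)
  let ?I = "{0..<2} \<times> {0..<m} :: (nat \<times> nat) set"
  show "col_puzzles m \<subseteq> (\<lambda>f. mat 2 m f) ` (?I \<rightarrow>\<^sub>E {1..2 * m})"
  proof
    fix X
    assume X: "X \<in> col_puzzles m"
    have "X = mat 2 m (restrict (\<lambda>rc. X $$ rc) ?I)"
      using col_puzzles_carrier[OF X] by (intro eq_matI) auto
    moreover have "restrict (\<lambda>rc. X $$ rc) ?I \<in> ?I \<rightarrow>\<^sub>E {1..2 * m}"
      using X by (auto simp: col_puzzles_def dest: bij_betwE)
    ultimately show "X \<in> (\<lambda>f. mat 2 m f) ` (?I \<rightarrow>\<^sub>E {1..2 * m})"
      by (rule image_eqI)
  qed
qed (auto intro!: finite_imageI finite_PiE)

lemma finite_Sset: "finite (Sset n S)"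
  by (rule finite_subset[OF _ finite_col_puzzles[of "n + 1"]]) (auto simp: Sset_def standard_puzzles_def)

section \<open>Directions along a supported puzzle\<close>

lemma Sset_columns:
  assumes "P \<subseteq> pieceA ` {1..6}" "Q \<subseteq> pieceA ` {1..6}" "y \<in> {1..6}"
    and X: "X \<in> Sset n (joined_pieces P y Q)" and c: "c < n"
  shows "reduction (piece_at X c) \<in> joined_pieces P y Q"
    and "reduction (piece_at X c) \<in> F2 ` P \<longleftrightarrow> \<not> up X (c + 1)"
    and "reduction (piece_at X c) \<in> F1 ` Q \<longleftrightarrow> up X c"
    and "up X c \<Longrightarrow> up X (c + 1)"
proof -
  have carrier: "X \<in> carrier_mat 2 (n + 1)"
    using X by (auto simp: Sset_def standard_puzzles_def col_puzzles_carrier)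
  then show *: "reduction (piece_at X c) \<in> joined_pieces P y Q"
    using X c by (auto simp: Sset_def is_support_def)
  show "reduction (piece_at X c) \<in> F2 ` P \<longleftrightarrow> \<not> up X (c + 1)"
    "reduction (piece_at X c) \<in> F1 ` Q \<longleftrightarrow> up X c" "up X c \<Longrightarrow> up X (c + 1)"
    using mem_joined_pieces[OF assms(1-3) *] up_piece[OF carrier, of c] c by simp_all
qed

lemma up_mono:
  assumes "\<And>c. c < n \<Longrightarrow> up X c \<Longrightarrow> up X (c + 1)" "c \<le> d" "d \<le> n" "up X c"
  shows "up X d"
  using assms(2,3) by (induction rule: dec_induct) (use assms(1,4) in auto)

text \<open>A down last column makes all columns down, since an up column is followed by up columns
  only; then every piece is of the down-down kind.\<close>

lemma Sset_all_down:
  assumes "P \<subseteq> pieceA ` {1..6}" "Q \<subseteq> pieceA ` {1..6}" "y \<in> {1..6}" "1 \<le> n"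
  shows "{X \<in> Sset n (joined_pieces P y Q). \<not> up X n} = Sset n (F2 ` P)"
proof (intro subset_antisym subsetI)
  fix X
  assume X: "X \<in> {X \<in> Sset n (joined_pieces P y Q). \<not> up X n}"
  then have "\<not> up X c" if "c \<le> n" for c
    using up_mono[of n X c n] Sset_columns(4)[OF assms(1-3)] that by auto
  then have "reduction (piece_at X c) \<in> F2 ` P" if "c < n" for c
    using Sset_columns(2)[OF assms(1-3), of X n c] X that by simp
  then show "X \<in> Sset n (F2 ` P)"
    using X col_puzzles_carrier[of X "n + 1"] F2_standard_pieces A_pieces_standard[OF assms(1)]
    by (auto simp: Sset_def standard_puzzles_def is_support_def)
next
  fix X
  assume X: "X \<in> Sset n (F2 ` P)"
  then have carrier: "X \<in> carrier_mat 2 (n + 1)"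
    by (auto simp: Sset_def standard_puzzles_def col_puzzles_carrier)
  have S: "X \<in> Sset n (joined_pieces P y Q)"
    using X joined_pieces_standard[OF assms(1-3)]
    by (auto simp: Sset_def is_support_def joined_pieces_def)
  \<comment> \<open>\<open>1 \<le> n\<close> provides a last piece, and being down-down it forces
    column \<open>n\<close> down.\<close>
  have "reduction (piece_at X (n - 1)) \<in> F2 ` P"
    using X carrier assms(4) by (auto simp: Sset_def is_support_def)
  with Sset_columns(2)[OF assms(1-3) S, of "n - 1"] assms(4) S
  show "X \<in> {X \<in> Sset n (joined_pieces P y Q). \<not> up X n}" by simp
qed

lemma Sset_all_up:
  assumes "P \<subseteq> pieceA ` {1..6}" "Q \<subseteq> pieceA ` {1..6}" "y \<in> {1..6}" "1 \<le> n"
  shows "{X \<in> Sset n (joined_pieces P y Q). up X 0} = Sset n (F1 ` Q)"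
proof (intro subset_antisym subsetI)
  fix X
  assume X: "X \<in> {X \<in> Sset n (joined_pieces P y Q). up X 0}"
  then have "up X c" if "c \<le> n" for c
    using up_mono[of n X 0 c] Sset_columns(4)[OF assms(1-3)] that by auto
  then have "reduction (piece_at X c) \<in> F1 ` Q" if "c < n" for c
    using Sset_columns(3)[OF assms(1-3), of X n c] X that by simp
  then show "X \<in> Sset n (F1 ` Q)"
    using X col_puzzles_carrier[of X "n + 1"] F1_standard_pieces A_pieces_standard[OF assms(2)]
    by (auto simp: Sset_def standard_puzzles_def is_support_def)
next
  fix X
  assume X: "X \<in> Sset n (F1 ` Q)"
  then have carrier: "X \<in> carrier_mat 2 (n + 1)"
    by (auto simp: Sset_def standard_puzzles_def col_puzzles_carrier)
  have S: "X \<in> Sset n (joined_pieces P y Q)"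
    using X joined_pieces_standard[OF assms(1-3)]
    by (auto simp: Sset_def is_support_def joined_pieces_def)
  have "reduction (piece_at X 0) \<in> F1 ` Q"
    using X carrier assms(4) by (auto simp: Sset_def is_support_def)
  with Sset_columns(3)[OF assms(1-3) S, of 0] assms(4) S
  show "X \<in> {X \<in> Sset n (joined_pieces P y Q). up X 0}" by simp
qed

section \<open>The sum as a count of joined puzzles\<close>

definition sum_range :: "nat \<Rightarrow> (nat \<times> nat \<times> nat \<times> nat \<times> nat \<times> nat) set" where
  "sum_range n = {(i, j, k, l, m, p). i \<ge> 1 \<and> j \<ge> 1 \<and> k \<ge> 1 \<and> l \<ge> 1 \<and> m \<ge> 1 \<and> p \<ge> 1 \<and>
     i + j \<le> 2 * m \<and> k + l \<le> 2 * p \<and> m + p = n + 1}"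

text \<open>The fibre over one index of the sum: a product of three sets, one for each factor of the
  summand.\<close>

definition join_data ::
  "nat mat set \<Rightarrow> nat \<Rightarrow> nat mat set \<Rightarrow> nat \<times> nat \<times> nat \<times> nat \<times> nat \<times> nat \<Rightarrow>
    (bool list \<times> nat mat \<times> nat mat) set" where
  "join_data P y Q = (\<lambda>(i, j, k, l, m, p). {w \<in> words True (2 * m) (2 * p). fits y i j k l w} \<times>
     ending_puzzles P i j m \<times> ending_puzzles Q k l p)"

lemma finite_sum_range: "finite (sum_range n)"
proof (rule finite_subset)
  let ?A = "{..2 * n + 2}"
  show "sum_range n \<subseteq> ?A \<times> ?A \<times> ?A \<times> ?A \<times> ?A \<times> ?A"
    by (auto simp: sum_range_def)
qed auto

lemma finite_ending_puzzles: "finite (ending_puzzles P i j m)"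
  by (rule finite_subset[OF _ finite_col_puzzles[of m]]) (auto simp: ending_puzzles_def)

lemma finite_join_data: "finite (join_data P y Q t)"
  by (cases t) (simp add: join_data_def finite_ending_puzzles finite_words)

lemma join_puzzles_inj:
  assumes "L \<in> col_puzzles m" "L' \<in> col_puzzles m" "R \<in> col_puzzles p" "R' \<in> col_puzzles p"
    and "w \<in> words True (2 * m) (2 * p)" "w' \<in> words True (2 * m) (2 * p)"
    and "join_puzzles w L R = join_puzzles w' L' R'"
  shows "w = w' \<and> L = L' \<and> R = R'"
proof -
  have "w = w' \<and> F2 L = F2 L' \<and> rev_cols R = rev_cols R'"
    using assms unfolding join_puzzles_def
    by (intro glue_inj) (auto intro: F2_col_puzzles rev_cols_col_puzzles)
  then show ?thesis
    using assms(1-4) by (metis F2_F2 rev_cols_rev_cols col_puzzles_carrier)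
qed

lemma join_puzzles_surj:
  assumes "X \<in> col_puzzles (m + p)"
  obtains w L R where "X = join_puzzles w L R" "w \<in> words True (2 * m) (2 * p)"
    "L \<in> col_puzzles m" "R \<in> col_puzzles p"
proof -
  obtain w L R where *: "X = glue w L R" "w \<in> words True (2 * m) (2 * p)"
    "L \<in> col_puzzles m" "R \<in> col_puzzles p"
    using glue_surj[OF assms] .
  then have "X = join_puzzles w (F2 L) (rev_cols R)"
    by (simp add: join_puzzles_def F2_F2[OF col_puzzles_carrier] rev_cols_rev_cols[OF col_puzzles_carrier])
  with * that F2_col_puzzles rev_cols_col_puzzles show thesis by blast
qed

lemma join_data_mem:
  assumes P: "P \<subseteq> pieceA ` {1..6}" and Q: "Q \<subseteq> pieceA ` {1..6}" and y: "y \<in> {1..6}"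
    and t: "(i, j, k, l, m, p) \<in> sum_range n" and d: "(w, L, R) \<in> join_data P y Q (i, j, k, l, m, p)"
  shows "join_puzzles w L R \<in> Sset n (joined_pieces P y Q)"
    and "\<And>c. c < n + 1 \<Longrightarrow> up (join_puzzles w L R) c \<longleftrightarrow> m \<le> c"
proof -
  have L: "L \<in> col_puzzles m" "is_support P L" "L $$ (1, m - 1) = i" "L $$ (0, m - 1) = i + j"
    and R: "R \<in> col_puzzles p" "is_support Q R" "R $$ (1, p - 1) = k" "R $$ (0, p - 1) = k + l"
    and w: "w \<in> words True (2 * m) (2 * p)" "fits y i j k l w"
    using d by (auto simp: join_data_def ending_puzzles_def)
  have mp: "1 \<le> m" "1 \<le> p" "1 \<le> j" "1 \<le> l" "m + p = n + 1"
    using t by (auto simp: sum_range_def)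
  have "reduction (piece_at (join_puzzles w L R) (m - 1)) = pieceC y"
    using reduction_join_middle[OF L(1) R(1) w(1) mp(1,2) y L(3,4) mp(3) R(3,4) mp(4)] w(2) by simp
  moreover have "up L (m - 1)" "up R (p - 1)"
    using L R mp by (auto simp: up_def)
  ultimately have "is_support (joined_pieces P y Q) (join_puzzles w L R) \<and>
      (\<forall>c<m + p. up (join_puzzles w L R) c \<longleftrightarrow> m \<le> c)"
    using join_support_iff[OF P Q y L(1) R(1) w(1) mp(1,2)] L(2) R(2) by simp
  then show "join_puzzles w L R \<in> Sset n (joined_pieces P y Q)"
    "\<And>c. c < n + 1 \<Longrightarrow> up (join_puzzles w L R) c \<longleftrightarrow> m \<le> c"
    using join_col_puzzles[OF L(1) R(1) w(1)] mp(5) by (auto simp: Sset_def standard_puzzles_def)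
qed

text \<open>For a puzzle that begins down and ends up, \<open>m\<close> is its first up column, the
  word and the two parts come from cutting there, and \<open>i\<close>, \<open>j\<close>,
  \<open>k\<close>, \<open>l\<close> are read off the last columns of the parts. So it arises from
  exactly one index and one triple.\<close>

lemma bij_join:
  assumes P: "P \<subseteq> pieceA ` {1..6}" and Q: "Q \<subseteq> pieceA ` {1..6}" and y: "y \<in> {1..6}"
  shows "bij_betw (\<lambda>(t, w, L, R). join_puzzles w L R) (Sigma (sum_range n) (join_data P y Q))
    {X \<in> Sset n (joined_pieces P y Q). \<not> up X 0 \<and> up X n}" (is "bij_betw ?f ?D ?J")
  unfolding bij_betw_def
proof (intro conjI subset_antisym subsetI)
  show "inj_on ?f ?D"
  proof (rule inj_onI)
    fix d d'
    assume d: "d \<in> ?D" "d' \<in> ?D" "?f d = ?f d'"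
    obtain i j k l m p w L R where d_eq: "d = ((i, j, k, l, m, p), w, L, R)"
      by (cases d) auto
    obtain i' j' k' l' m' p' w' L' R' where d'_eq: "d' = ((i', j', k', l', m', p'), w', L', R')"
      by (cases d') auto
    have t: "(i, j, k, l, m, p) \<in> sum_range n" "(i', j', k', l', m', p') \<in> sum_range n"
      and wLR: "(w, L, R) \<in> join_data P y Q (i, j, k, l, m, p)"
        "(w', L', R') \<in> join_data P y Q (i', j', k', l', m', p')"
      and eq: "join_puzzles w L R = join_puzzles w' L' R'"
      using d by (auto simp: d_eq d'_eq)
    have mp: "m < n + 1" "m' < n + 1" "m + p = n + 1" "m' + p' = n + 1"
      using t by (auto simp: sum_range_def)
    have "m \<le> c \<longleftrightarrow> m' \<le> c" if "c < n + 1" for c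
      using join_data_mem(2)[OF P Q y t(1) wLR(1) that] join_data_mem(2)[OF P Q y t(2) wLR(2) that]
      by (simp add: eq)
    \<comment> \<open>Both bounds are valid columns, so the equivalence can be taken at
      \<open>m\<close> and at \<open>m'\<close>.\<close>
    with mp(1,2) have m: "m = m'" by (meson order_antisym order_refl)
    with mp have p: "p = p'" by simp
    have "w = w' \<and> L = L' \<and> R = R'"
      using wLR eq by (intro join_puzzles_inj[of L m L' R p R']) (auto simp: join_data_def ending_puzzles_def m p)
    with wLR m p show "d = d'"
      by (auto simp: d_eq d'_eq join_data_def ending_puzzles_def)
  qed
next
  fix X
  assume "X \<in> ?f ` ?D"
  then obtain i j k l m p w L R where t: "(i, j, k, l, m, p) \<in> sum_range n"
    and d: "(w, L, R) \<in> join_data P y Q (i, j, k, l, m, p)" and X: "X = join_puzzles w L R"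
    by auto
  have "1 \<le> m" "m \<le> n"
    using t by (auto simp: sum_range_def)
  then show "X \<in> ?J"
    using join_data_mem(1)[OF P Q y t d] join_data_mem(2)[OF P Q y t d, of 0]
      join_data_mem(2)[OF P Q y t d, of n] by (simp add: X)
next
  fix X
  assume X: "X \<in> ?J"
  define m where "m = (LEAST c. up X c)"
  have m: "up X m" "\<And>c. up X c \<Longrightarrow> m \<le> c"
    unfolding m_def using X by (auto intro: LeastI Least_le)
  then have "m \<le> n" "m \<noteq> 0"
    using X by (blast, metis (no_types, lifting) mem_Collect_eq)
  have ups: "up X c \<longleftrightarrow> m \<le> c" if "c < n + 1" for c
    using m up_mono[of n X m c] Sset_columns(4)[OF P Q y] X that by auto
  define p where "p = n + 1 - m"
  have mp: "1 \<le> m" "1 \<le> p" "m + p = n + 1"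
    using \<open>m \<le> n\<close> \<open>m \<noteq> 0\<close> by (auto simp: p_def)
  have "X \<in> col_puzzles (m + p)"
    using X mp by (simp add: Sset_def standard_puzzles_def)
  then obtain w L R where X_eq: "X = join_puzzles w L R" and w: "w \<in> words True (2 * m) (2 * p)"
    and L: "L \<in> col_puzzles m" and R: "R \<in> col_puzzles p"
    by (rule join_puzzles_surj)
  have *: "is_support P L" "up L (m - 1)" "is_support Q R" "up R (p - 1)"
    "reduction (piece_at (join_puzzles w L R) (m - 1)) = pieceC y"
    using join_support_iff[OF P Q y L R w mp(1,2)] X ups mp(3) by (auto simp: X_eq Sset_def)
  define i where "i = L $$ (1, m - 1)"
  define j where "j = L $$ (0, m - 1) - i"
  define k where "k = R $$ (1, p - 1)"
  define l where "l = R $$ (0, p - 1) - k"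
  have ij: "L $$ (1, m - 1) = i" "L $$ (0, m - 1) = i + j" "1 \<le> j"
    and kl: "R $$ (1, p - 1) = k" "R $$ (0, p - 1) = k + l" "1 \<le> l"
    using *(2,4) by (auto simp: up_def i_def j_def k_def l_def)
  have "fits y i j k l w"
    using reduction_join_middle[OF L R w mp(1,2) y ij kl] *(5) by simp
  then have "(w, L, R) \<in> join_data P y Q (i, j, k, l, m, p)"
    using w L R * ij kl by (simp add: join_data_def ending_puzzles_def)
  \<comment> \<open>The entries of a standard puzzle bound \<open>i\<close>, \<open>i + j\<close>,
    \<open>k\<close>, \<open>k + l\<close>; positivity of \<open>j\<close> and \<open>l\<close> says
    that the last columns are up.\<close>
  moreover have "(i, j, k, l, m, p) \<in> sum_range n"
    using mp ij kl col_puzzles_range[OF L, of 1 "m - 1"] col_puzzles_range[OF L, of 0 "m - 1"]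
      col_puzzles_range[OF R, of 1 "p - 1"] col_puzzles_range[OF R, of 0 "p - 1"]
    by (auto simp: sum_range_def)
  ultimately have "((i, j, k, l, m, p), w, L, R) \<in> ?D" by simp
  then show "X \<in> ?f ` ?D"
    by (rule rev_image_eqI) (simp add: X_eq)
qed

lemma card_ending_puzzles: "card (ending_puzzles (simple_piece x) i j m) = Pnum x i j m"
  by (simp add: ending_puzzles_def Pnum_def)

text \<open>Consisting of A-pieces is what makes the direction argument apply to a 1-simple piece;
  the twenty index sets are checked by evaluation.\<close>

lemma simple_piece_subset:
  assumes "x \<in> {1..20}"
  shows "simple_piece x \<subseteq> pieceA ` {1..6}"
proof -
  have *: "pieceA ` (Is ! i) \<subseteq> pieceA ` {1..6}" if "list_all (\<lambda>I. I \<subseteq> {1..6}) Is" "i < length Is" for Is i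
    using that by (intro image_mono) (simp add: list_all_length)
  show ?thesis
    unfolding simple_piece_def by (rule *) (simp, use assms in \<open>simp, arith\<close>)
qed

text \<open>The range conditions supply the hypotheses of \<open>card_fits\<close>, under which the
  subtractions in \<open>Tnum\<close> do not truncate.\<close>

lemma card_join_data:
  assumes "t \<in> sum_range n"
  shows "card (join_data (simple_piece x) y (simple_piece z) t) =
    (case t of (i, j, k, l, m, p) \<Rightarrow> Pnum x i j m * Tnum y i j k l m p * Pnum z k l p)"
  using assms
  by (cases t) (auto simp: join_data_def sum_range_def card_cartesian_product card_fits
      card_ending_puzzles)

theorem corollary4p1:
  fixes x y z n :: nat and P Q T' P' Q' Qbar' :: "nat mat set"
  assumes "x \<in> {1..20}" and "z \<in> {1..20}" and "y \<in> {1..6}" and "n \<ge> 1"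
    and "P = simple_piece x" and "Q = simple_piece z" and "T' = {pieceC y}"
    and "P' = F2 ` P" and "Q' = F2 ` Q" and "Qbar' = (F1 \<circ> F2) ` Q'"
  shows "snum n (P' \<union> T' \<union> Qbar') =
    (\<Sum>(i, j, k, l, m, p) \<in> {(i, j, k, l, m, p).
          i \<ge> 1 \<and> j \<ge> 1 \<and> k \<ge> 1 \<and> l \<ge> 1 \<and> m \<ge> 1 \<and> p \<ge> 1 \<and>
          i + j \<le> 2 * m \<and> k + l \<le> 2 * p \<and> m + p = n + 1}.
        Pnum x i j m * Tnum y i j k l m p * Pnum z k l p) + snum n P + snum n Q"
proof -
  define S where "S = joined_pieces P y Q"
  have A: "P \<subseteq> pieceA ` {1..6}" "Q \<subseteq> pieceA ` {1..6}" "y \<in> {1..6}"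
    using assms simple_piece_subset by simp_all
  note std = A_pieces_standard[OF A(1)] A_pieces_standard[OF A(2)]
  have "F2 (F2 M) = M" if "M \<in> Q" for M
    using that F2_F2 standard_pieces_carrier[OF std(2)] by blast
  then have "Qbar' = F1 ` Q"
    unfolding assms(9,10) image_image comp_def by (intro image_cong) simp_all
  then have S: "P' \<union> T' \<union> Qbar' = S"
    by (simp add: S_def joined_pieces_def assms(7,8))
  let ?J = "{X \<in> Sset n S. \<not> up X 0 \<and> up X n}"
  have up: "up X n" if "X \<in> Sset n S" "up X 0" for X
    using up_mono[of n X 0 n] Sset_columns(4)[OF A, of X n] that unfolding S_def by blast
  \<comment> \<open>The first and last columns sort the puzzles into those that change direction,
    those all down and those all up; the last two classes are disjoint because an up first column
    forces an up last column.\<close>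
  then have "Sset n S = ?J \<union> ({X \<in> Sset n S. \<not> up X n} \<union> {X \<in> Sset n S. up X 0})"
    by blast
  moreover have "?J \<inter> ({X \<in> Sset n S. \<not> up X n} \<union> {X \<in> Sset n S. up X 0}) = {}"
    "{X \<in> Sset n S. \<not> up X n} \<inter> {X \<in> Sset n S. up X 0} = {}"
    using up by blast+
  ultimately have "card (Sset n S) = card ?J + (card {X \<in> Sset n S. \<not> up X n} + card {X \<in> Sset n S. up X 0})"
    using finite_Sset[of n S] by (metis (no_types, lifting) card_Un_disjoint finite_Un)
  also have "{X \<in> Sset n S. \<not> up X n} = Sset n (F2 ` P)"
    unfolding S_def using A assms(4) by (rule Sset_all_down)
  also have "card \<dots> = snum n P"
    using snum_F2[OF std(1)] by (simp add: snum_def)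
  also have "{X \<in> Sset n S. up X 0} = Sset n (F1 ` Q)"
    unfolding S_def using A assms(4) by (rule Sset_all_up)
  also have "card \<dots> = snum n Q"
    using snum_F1[OF std(2)] by (simp add: snum_def)
  \<comment> \<open>The index is part of the data counted, so the cardinalities of the fibres add
    up.\<close>
  also have "card ?J = (\<Sum>t\<in>sum_range n. card (join_data P y Q t))"
    unfolding S_def bij_betw_same_card[OF bij_join[OF A], symmetric]
    by (rule card_SigmaI) (simp_all add: finite_sum_range finite_join_data)
  also have "\<dots> = (\<Sum>(i, j, k, l, m, p)\<in>sum_range n. Pnum x i j m * Tnum y i j k l m p * Pnum z k l p)"
    unfolding assms(5,6) by (intro sum.cong refl card_join_data)
  finally show ?thesis
    unfolding S snum_def sum_range_def add.assoc .
qed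


end
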